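(* Let $\ell$ be a positive integer, $N=\tfrac12\ell(\ell+1)$, $\tau\in\mathbb C$ with $\mathrm{Im}\,\tau>0$, and let $\eta$ be generic. Consider the pole ansatz $$c(x)=\frac{\rho(x+\eta)\,\rho(x-2\eta)}{\rho(x)\,\rho(x-\eta)},\qquad \rho(x)=\prod_{j=1}^{N}\theta_1(x-x_j),$$ with $x_j=x_j(t)$, for the Volterra equation $$\frac{\partial c(x)}{\partial t}=-c(x)\big(c(x+\eta)-c(x-\eta)\big).$$ Substituting this ansatz into the Volterra equation and requiring the residues at the poles to be zero, one gets the following two systems of equations, $j=1,\dots,N$: $$\frac{\theta_1'(0)}{\theta_1(2\eta)}\,\dot x_j=\prod_{k=1,\,k\ne j}^{N}\frac{\theta_1(x_j-x_k+2\eta)\,\theta_1(x_j-x_k-\eta)}{\theta_1(x_j-x_k+\eta)\,\theta_1(x_j-x_k)},$$ $$\frac{\theta_1'(0)}{\theta_1(2\eta)}\,\dot x_j=\prod_{k=1,\,k\ne j}^{N}\frac{\theta_1(x_j-x_k-2\eta)\,\theta_1(x_j-x_k+\eta)}{\theta_1(x_j-x_k-\eta)\,\theta_1(x_j-x_k)}.$$ The two systems must be satisfied simultaneously, so their right-hand sides are identical; hence necessary conditions for solutions to exist are the locus equations $$\prod_{k=1,\,k\ne j}^{N}\frac{\theta_1(x_j-x_k+2\eta)\,\theta_1^2(x_j-x_k-\eta)}{\theta_1(x_j-x_k-2\eta)\,\theta_1^2(x_j-x_k+\eta)}=1,\qquad j=1,\dots,N.$$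
   Context: $\theta_1(x)=\theta_1(x|\tau)=-\sum_{k\in\mathbb Z}\exp\big(\pi i\tau(k+\tfrac12)^2+2\pi i(x+\tfrac12)(k+\tfrac12)\big)$ is the odd Jacobi theta function, and $\theta_1'$ is its derivative in $x$. The parameter $\eta$ is the lattice spacing, and a dot denotes $\partial/\partial t$. The function $c(x)$ is elliptic in $x$ with periods $1$ and $\tau$; it is the coefficient in the difference spectral problem $\psi(x+\eta)+c(x)\psi(x-\eta)=E\psi(x)$, whose isospectral flows are the flows of the Volterra hierarchy, the equation above being the first one. The difference Lamé operator, with $c(x)=\frac{\theta_1(x+\ell\eta)\theta_1(x-(\ell+1)\eta)}{\theta_1(x)\theta_1(x-\eta)}$, corresponds to the degenerate configuration $\rho(x)=\prod_{1\le j\le k\le\ell}\theta_1(x+(j+k-\ell-1)\eta)$. Solving the Volterra equation with this initial condition gives a family of isospectral deformations of the difference Lamé operator; this degenerate configuration lies in the closure of the (non-compact) locus. *)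

theory Defs
  imports "HOL-Complex_Analysis.Complex_Analysis"
begin

definition theta1 :: "complex \<Rightarrow> complex \<Rightarrow> complex" where
  "theta1 \<tau> x =
     - infsum (\<lambda>k::int. exp (of_real pi * \<i> * \<tau> * (of_int k + 1/2)\<^sup>2
                            + 2 * of_real pi * \<i> * (x + 1/2) * (of_int k + 1/2))) UNIV"

text \<open>A configuration \<open>X\<close> is a family of points \<open>X 1, \<dots>, X N\<close>.\<close>

definition rho :: "complex \<Rightarrow> nat \<Rightarrow> (nat \<Rightarrow> complex) \<Rightarrow> complex \<Rightarrow> complex" where
  "rho \<tau> N X x = (\<Prod>j=1..N. theta1 \<tau> (x - X j))"

definition pole_ansatz ::
    "complex \<Rightarrow> complex \<Rightarrow> nat \<Rightarrow> (nat \<Rightarrow> complex) \<Rightarrow> complex \<Rightarrow> complex" where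
  "pole_ansatz \<tau> \<eta> N X x =
     rho \<tau> N X (x + \<eta>) * rho \<tau> N X (x - 2 * \<eta>) / (rho \<tau> N X x * rho \<tau> N X (x - \<eta>))"

text \<open>The equation is only required at points \<open>z\<close> at which none of the
  denominators of \<open>c(z)\<close>, \<open>c(z + \<eta>)\<close>, \<open>c(z - \<eta>)\<close> vanishes, where \<open>c\<close> is the pole ansatz.\<close>

definition ansatz_solves_volterra ::
    "complex \<Rightarrow> complex \<Rightarrow> nat \<Rightarrow> real set \<Rightarrow> (nat \<Rightarrow> real \<Rightarrow> complex) \<Rightarrow> bool" where
  "ansatz_solves_volterra \<tau> \<eta> N T x \<longleftrightarrow>
     (let \<rho> = (\<lambda>t. rho \<tau> N (\<lambda>j. x j t)); c = (\<lambda>t. pole_ansatz \<tau> \<eta> N (\<lambda>j. x j t)) in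
      \<forall>t\<in>T. \<forall>z. \<rho> t z \<noteq> 0 \<and> \<rho> t (z + \<eta>) \<noteq> 0 \<and> \<rho> t (z - \<eta>) \<noteq> 0 \<and> \<rho> t (z - 2 * \<eta>) \<noteq> 0 \<longrightarrow>
        ((\<lambda>s. c s z) has_vector_derivative - c t z * (c t (z + \<eta>) - c t (z - \<eta>))) (at t))"

text \<open>The two sides of the Volterra equation, divided by \<open>c\<close>, subtracted from each other:
  \<open>\<partial>\<^sub>t c(z) / c(z) + c(z + \<eta>) - c(z - \<eta>)\<close>.  For a nondegenerate configuration
  this has only simple poles in \<open>z\<close> (before the division there are double poles), so
  that it has no poles exactly if all its residues vanish.\<close>

definition volterra_defect ::
    "complex \<Rightarrow> complex \<Rightarrow> nat \<Rightarrow> (nat \<Rightarrow> real \<Rightarrow> complex) \<Rightarrow> real \<Rightarrow> complex \<Rightarrow> complex" where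
  "volterra_defect \<tau> \<eta> N x t z =
     (let c = (\<lambda>t. pole_ansatz \<tau> \<eta> N (\<lambda>j. x j t)) in
      vector_derivative (\<lambda>s. c s z) (at t) / c t z + c t (z + \<eta>) - c t (z - \<eta>))"

definition system1_rhs :: "complex \<Rightarrow> complex \<Rightarrow> nat \<Rightarrow> (nat \<Rightarrow> complex) \<Rightarrow> nat \<Rightarrow> complex" where
  "system1_rhs \<tau> \<eta> N X j =
     (\<Prod>k\<in>{1..N} - {j}. theta1 \<tau> (X j - X k + 2 * \<eta>) * theta1 \<tau> (X j - X k - \<eta>)
                       / (theta1 \<tau> (X j - X k + \<eta>) * theta1 \<tau> (X j - X k)))"

definition system2_rhs :: "complex \<Rightarrow> complex \<Rightarrow> nat \<Rightarrow> (nat \<Rightarrow> complex) \<Rightarrow> nat \<Rightarrow> complex" where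
  "system2_rhs \<tau> \<eta> N X j =
     (\<Prod>k\<in>{1..N} - {j}. theta1 \<tau> (X j - X k - 2 * \<eta>) * theta1 \<tau> (X j - X k + \<eta>)
                       / (theta1 \<tau> (X j - X k - \<eta>) * theta1 \<tau> (X j - X k)))"

definition both_systems ::
    "complex \<Rightarrow> complex \<Rightarrow> nat \<Rightarrow> (nat \<Rightarrow> real \<Rightarrow> complex) \<Rightarrow> real \<Rightarrow> bool" where
  "both_systems \<tau> \<eta> N x t \<longleftrightarrow>
     (\<forall>j\<in>{1..N}.
        deriv (theta1 \<tau>) 0 / theta1 \<tau> (2 * \<eta>) * vector_derivative (x j) (at t)
          = system1_rhs \<tau> \<eta> N (\<lambda>i. x i t) j \<and>
        deriv (theta1 \<tau>) 0 / theta1 \<tau> (2 * \<eta>) * vector_derivative (x j) (at t)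
          = system2_rhs \<tau> \<eta> N (\<lambda>i. x i t) j)"

definition locus_equations :: "complex \<Rightarrow> complex \<Rightarrow> nat \<Rightarrow> (nat \<Rightarrow> complex) \<Rightarrow> bool" where
  "locus_equations \<tau> \<eta> N X \<longleftrightarrow>
     (\<forall>j\<in>{1..N}.
        (\<Prod>k\<in>{1..N} - {j}. theta1 \<tau> (X j - X k + 2 * \<eta>) * (theta1 \<tau> (X j - X k - \<eta>))\<^sup>2
                          / (theta1 \<tau> (X j - X k - 2 * \<eta>) * (theta1 \<tau> (X j - X k + \<eta>))\<^sup>2)) = 1)"

text \<open>Nonvanishing of all denominators of the two systems and of the locus equations.\<close>

definition nondegenerate :: "complex \<Rightarrow> complex \<Rightarrow> nat \<Rightarrow> (nat \<Rightarrow> complex) \<Rightarrow> bool" where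
  "nondegenerate \<tau> \<eta> N X \<longleftrightarrow>
     (\<forall>j\<in>{1..N}. \<forall>k\<in>{1..N}. j \<noteq> k \<longrightarrow>
        (\<forall>s\<in>{0, \<eta>, - \<eta>, 2 * \<eta>, - 2 * \<eta>}. theta1 \<tau> (X j - X k + s) \<noteq> 0))"

end

theory Submission
  imports Defs
begin

text \<open>
  The theta function is entire and quasi-periodic. It vanishes on the lattice, so its quotient by
  the Jacobi product, whose zeros are the lattice points and are simple, is entire and elliptic,
  hence constant. Therefore \<open>theta1 \<tau>\<close>, which does not vanish at \<open>\<eta>\<close>, has simple zeros exactly on
  the lattice. Away from a discrete set the Volterra defect equals
  \<open>L(z) + c(z + \<eta>) - c(z - \<eta>)\<close>, where \<open>L\<close> is a combination of logarithmic derivatives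
  \<open>theta1' / theta1\<close> with coefficients \<open>\<plusminus> dx\<^sub>j/dt\<close>. Its poles lie, modulo the lattice, at
  \<open>x\<^sub>j\<close> and \<open>x\<^sub>j + 2\<eta>\<close>, where the residue is, up to sign, the difference of the two sides of the
  first system, and at \<open>x\<^sub>j + \<eta>\<close> and \<open>x\<^sub>j - \<eta>\<close>, where it is that of the second system. Dividing the
  right-hand sides of the two systems by each other gives the locus equations.
\<close>

section \<open>The theta series\<close>

text \<open>Up to a constant factor this is the majorant for the theta series on a disc. The
  integers are covered by the images of \<open>n\<close> and \<open>- n\<close>, and over each of
  them the series is geometric.\<close>

lemma summable_on_exp_neg_abs_int: "(\<lambda>k::int. exp (- \<bar>real_of_int k\<bar>)) summable_on UNIV"
proof -
  have nat: "(\<lambda>n::nat. exp (- real n)) summable_on UNIV"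
  proof -
    have "summable (\<lambda>n. exp (-1::real) ^ n)"
      by (rule summable_geometric) simp
    moreover have "(\<lambda>n. exp (-1::real) ^ n) = (\<lambda>n. exp (- real n))"
      by (simp flip: exp_of_nat_mult)
    ultimately show ?thesis
      by (intro norm_summable_imp_summable_on) simp
  qed
  have "(\<lambda>k::int. exp (- \<bar>real_of_int k\<bar>)) summable_on range int"
    using nat by (subst summable_on_reindex) (auto simp: o_def)
  moreover have "(\<lambda>k::int. exp (- \<bar>real_of_int k\<bar>)) summable_on range (\<lambda>n. - int n)"
    using nat by (subst summable_on_reindex) (auto simp: o_def inj_def)
  ultimately have "(\<lambda>k::int. exp (- \<bar>real_of_int k\<bar>)) summable_on (range int \<union> range (\<lambda>n. - int n))"
    by (rule summable_on_union)
  moreover have "range int \<union> range (\<lambda>n. - int n) = UNIV"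
  proof -
    have "k \<in> range int \<union> range (\<lambda>n. - int n)" for k
      by (cases k rule: int_cases2) auto
    then show ?thesis by blast
  qed
  ultimately show ?thesis by simp
qed

definition theta1_term :: "complex \<Rightarrow> int \<Rightarrow> complex \<Rightarrow> complex" where
  "theta1_term \<tau> k x = exp (of_real pi * \<i> * \<tau> * (of_int k + 1/2)\<^sup>2
                            + 2 * of_real pi * \<i> * (x + 1/2) * (of_int k + 1/2))"

lemma theta1_eq_infsum_term: "theta1 \<tau> x = - (\<Sum>\<^sub>\<infinity>k. theta1_term \<tau> k x)"
  by (simp add: theta1_def theta1_term_def)

text \<open>With \<open>m = k + 1/2\<close>, the Gaussian decay in \<open>m\<close> beats the growth
  \<open>exp (2 * pi * R * \<bar>m\<bar>)\<close> on the disc of radius \<open>R\<close>. The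
  constant 1/2 pays for replacing \<open>\<bar>m\<bar>\<close> by
  \<open>\<bar>k\<bar>\<close>.\<close>

lemma norm_theta1_term_le:
  assumes "Im \<tau> > 0" and "norm x \<le> R"
  shows "norm (theta1_term \<tau> k x)
           \<le> exp ((2 * pi * R + 1)\<^sup>2 / (4 * (pi * Im \<tau>)) + 1/2) * exp (- \<bar>real_of_int k\<bar>)"
proof -
  define m where "m = real_of_int k + 1/2"
  define a where "a = pi * Im \<tau>"
  \<comment> \<open>The summand 1 reserves the decay \<open>exp (- \<bar>m\<bar>)\<close> that
    remains after completing the square.\<close>
  define b where "b = 2 * pi * R + 1"
  have a: "a > 0" using assms by (simp add: a_def)
  have m: "complex_of_int k + 1/2 = of_real m" by (simp add: m_def)
  have "norm (theta1_term \<tau> k x) = exp (- a * m\<^sup>2 - 2 * pi * Im x * m)"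
    unfolding theta1_term_def m a_def by (simp flip: of_real_power add: algebra_simps)
  also have "\<dots> \<le> exp (b\<^sup>2 / (4 * a) + 1/2 + - \<bar>real_of_int k\<bar>)"
  proof -
    have "\<bar>Im x\<bar> \<le> R" using assms(2) abs_Im_le_cmod order_trans by blast
    then have "\<bar>Im x\<bar> * \<bar>m\<bar> \<le> R * \<bar>m\<bar>" by (simp add: mult_right_mono)
    then have "- (Im x * m) \<le> R * \<bar>m\<bar>" by (simp flip: abs_mult)
    then have "pi * (- (Im x * m)) \<le> pi * (R * \<bar>m\<bar>)" by (simp only: mult_left_mono pi_ge_zero)
    then have 1: "- 2 * pi * Im x * m \<le> 2 * pi * R * \<bar>m\<bar>" by (simp add: algebra_simps)
    \<comment> \<open>Completing the square bounds \<open>b * \<bar>m\<bar> - a * m\<^sup>2\<close>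
      by its maximum \<open>b\<^sup>2 / (4 * a)\<close>.\<close>
    have "0 \<le> (2 * a * \<bar>m\<bar> - b)\<^sup>2" by simp
    also have "\<dots> = 4 * a * (a * m\<^sup>2 - b * \<bar>m\<bar>) + b\<^sup>2"
      by (simp add: power2_diff algebra_simps power_mult_distrib) (simp add: power2_eq_square)
    finally have "- (a * m\<^sup>2 - b * \<bar>m\<bar>) \<le> b\<^sup>2 / (4 * a)"
      using a by (simp add: field_simps)
    moreover have "b * \<bar>m\<bar> = 2 * pi * R * \<bar>m\<bar> + \<bar>m\<bar>" by (simp add: b_def algebra_simps)
    moreover have "\<bar>real_of_int k\<bar> \<le> \<bar>m\<bar> + 1/2" by (simp add: m_def)
    ultimately show ?thesis using 1 unfolding exp_le_cancel_iff by linarith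
  qed
  finally show ?thesis by (simp add: a_def b_def flip: exp_add)
qed

text \<open>The Weierstrass M-test, along the net of finite sets of integers that underlies
  \<open>infsum\<close>, gives uniform convergence on every disc, and the discs exhaust the
  plane.\<close>

lemma theta1_holomorphic:
  assumes "Im \<tau> > 0"
  shows "theta1 \<tau> holomorphic_on UNIV"
proof -
  have "theta1 \<tau> holomorphic_on ball 0 R" for R
  proof -
    define M where "M = (\<lambda>k::int. exp ((2 * pi * R + 1)\<^sup>2 / (4 * (pi * Im \<tau>)) + 1/2)
      * exp (- \<bar>real_of_int k\<bar>))"
    have "uniform_limit (cball 0 R) (\<lambda>X y. \<Sum>k\<in>X. theta1_term \<tau> k y)
        (\<lambda>y. \<Sum>\<^sub>\<infinity>k. theta1_term \<tau> k y) (finite_subsets_at_top UNIV)"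
    proof (rule Weierstrass_m_test_general[where M = M])
      show "M summable_on UNIV"
        unfolding M_def by (intro summable_on_cmult_right summable_on_exp_neg_abs_int)
      fix k and y :: complex assume "y \<in> cball 0 R"
      then show "norm (theta1_term \<tau> k y) \<le> M k"
        unfolding M_def by (intro norm_theta1_term_le assms) simp
    qed
    then obtain "(\<lambda>y. \<Sum>\<^sub>\<infinity>k. theta1_term \<tau> k y) holomorphic_on ball 0 R"
      by (rule holomorphic_uniform_limit[rotated])
         (auto simp: theta1_term_def intro!: always_eventually holomorphic_intros
               holomorphic_on_imp_continuous_on)
    then show ?thesis
      unfolding theta1_eq_infsum_term by (intro holomorphic_intros)
  qed
  then show ?thesis
    by (metis UNIV_I centre_in_ball field_differentiable_at_within holomorphic_onI
        holomorphic_on_open holomorphic_on_imp_differentiable_at mem_ball_0 open_ball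
        less_add_one)
qed

section \<open>Oddness and quasi-periodicity\<close>

lemma exp_int_mult_2_pi_i: "exp (of_int k * (2 * of_real pi * \<i>)) = 1"
  by (auto simp: exp_eq_1)

lemma exp_pi_i_odd: "exp (2 * of_real pi * \<i> * (of_int k + 1/2)) = -1"
proof -
  have "exp (2 * of_real pi * \<i> * (of_int k + 1/2))
      = exp (of_int k * (2 * of_real pi * \<i>)) * exp (of_real pi * \<i>)"
    by (simp add: algebra_simps flip: exp_add)
  then show ?thesis by (simp only: exp_int_mult_2_pi_i exp_pi_i) simp
qed

text \<open>The involution sending \<open>k\<close> to \<open>- 1 - k\<close> negates
  \<open>k + 1/2\<close>. It matches the terms at \<open>- x\<close> and at \<open>x\<close> up to
  \<open>exp (2 * of_real pi * \<i> * (of_int k + 1/2)) = -1\<close>, which stems from the 1/2 in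
  \<open>x + 1/2\<close>.\<close>

lemma theta1_minus: "theta1 \<tau> (- x) = - theta1 \<tau> x"
proof -
  have "(\<Sum>\<^sub>\<infinity>k. theta1_term \<tau> k (- x)) = (\<Sum>\<^sub>\<infinity>k. theta1_term \<tau> (- 1 - k) (- x))"
    by (rule infsum_reindex_bij_betw[symmetric]) (rule bij_betw_byWitness[where f' = "\<lambda>k. - 1 - k"], auto)
  also have "\<dots> = (\<Sum>\<^sub>\<infinity>k. - theta1_term \<tau> k x)"
  proof (rule infsum_cong)
    fix k
    have "theta1_term \<tau> k x = theta1_term \<tau> (- 1 - k) (- x)
        * exp (2 * of_real pi * \<i> * (of_int k + 1/2))"
      unfolding theta1_term_def
      by (simp flip: exp_add) (simp add: algebra_simps power2_eq_square)
    then show "theta1_term \<tau> (- 1 - k) (- x) = - theta1_term \<tau> k x"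
      by (simp only: exp_pi_i_odd) simp
  qed
  finally show ?thesis by (simp add: theta1_eq_infsum_term infsum_uminus)
qed

lemma theta1_0 [simp]: "theta1 \<tau> 0 = 0"
  using theta1_minus[of \<tau> 0] by simp

text \<open>The factor of automorphy for translation by \<open>m + n * \<tau>\<close>. The sign
  \<open>(-1) ^ (m + n)\<close> is kept in the exponent, so that products of factors can be compared
  by adding exponents.\<close>

definition theta1_factor :: "complex \<Rightarrow> int \<Rightarrow> int \<Rightarrow> complex \<Rightarrow> complex" where
  "theta1_factor \<tau> m n x = exp (of_real pi * \<i> * (of_int m - of_int n - of_int n ^ 2 * \<tau> - 2 * of_int n * x))"

lemma theta1_factor_nonzero [simp]: "theta1_factor \<tau> m n x \<noteq> 0"
  by (simp add: theta1_factor_def)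

text \<open>Since \<open>(k + 1/2)\<^sup>2 + 2 * n * (k + 1/2) = (k + n + 1/2)\<^sup>2 -
  n\<^sup>2\<close>, translation by \<open>n * \<tau>\<close> shifts the summation index by
  \<open>n\<close>; translation by \<open>m\<close> only contributes the sign
  \<open>(-1) ^ m\<close>.\<close>

lemma theta1_add_lattice:
  "theta1 \<tau> (x + of_int m + of_int n * \<tau>) = theta1_factor \<tau> m n x * theta1 \<tau> x"
proof -
  have "(\<Sum>\<^sub>\<infinity>k. theta1_term \<tau> k (x + of_int m + of_int n * \<tau>))
      = (\<Sum>\<^sub>\<infinity>k. theta1_factor \<tau> m n x * theta1_term \<tau> (k + n) x)"
  proof (rule infsum_cong)
    fix k
    have "theta1_term \<tau> k (x + of_int m + of_int n * \<tau>)
       = theta1_factor \<tau> m n x * theta1_term \<tau> (k + n) x * exp (of_int (m * k) * (2 * of_real pi * \<i>))"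
      unfolding theta1_term_def theta1_factor_def
      by (simp flip: exp_add) (simp add: algebra_simps power2_eq_square)
    also have "exp (of_int (m * k) * (2 * of_real pi * \<i>)) = 1"
      by (rule exp_int_mult_2_pi_i)
    finally show "theta1_term \<tau> k (x + of_int m + of_int n * \<tau>)
       = theta1_factor \<tau> m n x * theta1_term \<tau> (k + n) x" by simp
  qed
  also have "\<dots> = theta1_factor \<tau> m n x * (\<Sum>\<^sub>\<infinity>k. theta1_term \<tau> (k + n) x)"
    by (rule infsum_cmult_right')
  also have "(\<Sum>\<^sub>\<infinity>k. theta1_term \<tau> (k + n) x) = (\<Sum>\<^sub>\<infinity>k. theta1_term \<tau> k x)"
    by (rule infsum_reindex_bij_betw) (rule bij_betw_byWitness[where f' = "\<lambda>k. k - n"], auto)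
  finally show ?thesis by (simp add: theta1_eq_infsum_term)
qed

lemma theta1_lattice [simp]: "theta1 \<tau> (of_int m + of_int n * \<tau>) = 0"
  using theta1_add_lattice[of \<tau> 0 m n] by simp

section \<open>The zeros of the theta function\<close>

text \<open>The closed form is \<open>(-1) ^ n * q ^ (n * (n - 1) / 2)\<close> divided by the
  product of \<open>1 - q ^ i\<close> for \<open>i = 1..n\<close>. The recursion is the one that the
  functional equation \<open>qpoch_step\<close> imposes on the coefficients.\<close>

primrec qpoch_coeff :: "complex \<Rightarrow> nat \<Rightarrow> complex" where
  "qpoch_coeff q 0 = 1"
| "qpoch_coeff q (Suc n) = - (q ^ n) * qpoch_coeff q n / (1 - q ^ Suc n)"

text \<open>Euler's series for the infinite product of the factors \<open>1 - q ^ n * w\<close>.\<close>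

definition qpoch :: "complex \<Rightarrow> complex \<Rightarrow> complex" where
  "qpoch q w = (\<Sum>n. qpoch_coeff q n * w ^ n)"

lemma power_neq_1:
  fixes q :: complex
  assumes "norm q < 1" shows "q ^ Suc n \<noteq> 1"
  by (metis assms norm_one norm_power order_less_irrefl power_Suc_less_one norm_ge_zero power_less_one_iff zero_less_Suc)

text \<open>The ratio of consecutive terms tends to 0, so the radius of convergence is
  infinite.\<close>

lemma summable_qpoch:
  assumes "norm q < 1"
  shows "summable (\<lambda>n. qpoch_coeff q n * w ^ n)"
proof -
  have "(\<lambda>n. q ^ n * w / (1 - q ^ Suc n)) \<longlonglongrightarrow> 0 * w / (1 - 0)"
    using assms by (intro tendsto_intros LIMSEQ_power_zero LIMSEQ_Suc[OF LIMSEQ_power_zero]) auto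
  then have "\<forall>\<^sub>F n in sequentially. norm (q ^ n * w / (1 - q ^ Suc n)) < 1/2"
    by (auto simp: tendsto_iff dest: spec[of _ "1/2"])
  then obtain N where N: "norm (q ^ n * w / (1 - q ^ Suc n)) < 1/2" if "n \<ge> N" for n
    by (auto simp: eventually_sequentially)
  show ?thesis
  proof (rule summable_ratio_test[where c = "1/2" and N = N])
    fix n assume "n \<ge> N"
    have "qpoch_coeff q (Suc n) * w ^ Suc n
        = - (q ^ n * w / (1 - q ^ Suc n)) * (qpoch_coeff q n * w ^ n)"
      by simp
    then have "norm (qpoch_coeff q (Suc n) * w ^ Suc n)
        = norm (q ^ n * w / (1 - q ^ Suc n)) * norm (qpoch_coeff q n * w ^ n)"
      by (simp only: norm_mult norm_minus_cancel)
    also have "\<dots> \<le> 1/2 * norm (qpoch_coeff q n * w ^ n)"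
      using N[OF \<open>n \<ge> N\<close>] by (intro mult_right_mono) auto
    finally show "norm (qpoch_coeff q (Suc n) * w ^ Suc n) \<le> 1/2 * norm (qpoch_coeff q n * w ^ n)" .
  qed simp
qed

lemma qpoch_holomorphic:
  assumes "norm q < 1"
  shows "qpoch q holomorphic_on UNIV"
  using termdiffs_strong_converges_everywhere[OF summable_qpoch[OF assms]]
  unfolding qpoch_def holomorphic_on_def field_differentiable_def by blast

lemma qpoch_compose_holomorphic:
  assumes "norm q < 1" and "g holomorphic_on A"
  shows "(\<lambda>x. qpoch q (g x)) holomorphic_on A"
  using holomorphic_on_compose_gen[OF assms(2) qpoch_holomorphic[OF assms(1)]] by (simp add: o_def)

text \<open>Comparison of coefficients, using \<open>c\<close> below. In terms of the infinite
  product, the factor with index 0 is split off.\<close>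

lemma qpoch_step:
  assumes "norm q < 1"
  shows "qpoch q w = (1 - w) * qpoch q (q * w)"
proof -
  note s = summable_qpoch[OF assms]
  have c: "qpoch_coeff q (Suc n) * (1 - q ^ Suc n) = - (q ^ n) * qpoch_coeff q n" for n
    using power_neq_1[OF assms, of n] by simp
  have "qpoch q w - qpoch q (q * w) = (\<Sum>n. qpoch_coeff q n * w ^ n - qpoch_coeff q n * (q * w) ^ n)"
    unfolding qpoch_def by (rule suminf_diff[OF s s])
  also have "\<dots> = (\<Sum>n. qpoch_coeff q (Suc n) * w ^ Suc n - qpoch_coeff q (Suc n) * (q * w) ^ Suc n)"
    by (subst suminf_split_head[OF summable_diff[OF s s]]) simp
  also have "\<dots> = (\<Sum>n. - w * (qpoch_coeff q n * (q * w) ^ n))"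
  proof (rule suminf_cong)
    fix n
    have "qpoch_coeff q (Suc n) * w ^ Suc n - qpoch_coeff q (Suc n) * (q * w) ^ Suc n
        = qpoch_coeff q (Suc n) * (1 - q ^ Suc n) * w ^ Suc n"
      by (simp add: power_mult_distrib right_diff_distrib left_diff_distrib del: qpoch_coeff.simps power_Suc)
    also have "\<dots> = - w * (qpoch_coeff q n * (q * w) ^ n)"
      by (simp only: c) (simp add: power_mult_distrib)
    finally show "qpoch_coeff q (Suc n) * w ^ Suc n - qpoch_coeff q (Suc n) * (q * w) ^ Suc n
        = - w * (qpoch_coeff q n * (q * w) ^ n)" .
  qed
  also have "\<dots> = - w * qpoch q (q * w)"
    unfolding qpoch_def by (rule suminf_mult[OF s])
  finally show ?thesis by (simp add: algebra_simps)
qed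

text \<open>If no factor vanishes, \<open>qpoch_step\<close> carries a zero at \<open>w\<close>
  along the whole sequence \<open>q ^ n * w\<close>. This sequence tends to 0, where the continuous
  function \<open>qpoch q\<close> has the value 1.\<close>

lemma qpoch_eq_0D:
  assumes "norm q < 1" and "qpoch q w = 0"
  shows "\<exists>n. q ^ n * w = 1"
proof (rule ccontr)
  assume neq: "\<nexists>n. q ^ n * w = 1"
  have zero: "qpoch q (q ^ n * w) = 0" for n
  proof (induction n)
    case (Suc n)
    then show ?case
      using qpoch_step[OF assms(1), of "q ^ n * w"] neq by (auto simp: mult.assoc)
  qed (use assms in simp)
  have "(\<lambda>n. q ^ n * w) \<longlonglongrightarrow> 0 * w"
    using assms by (intro tendsto_intros LIMSEQ_power_zero)
  moreover have "isCont (qpoch q) 0"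
    using qpoch_holomorphic[OF assms(1)]
    by (metis UNIV_I continuous_on_eq_continuous_at holomorphic_on_imp_continuous_on open_UNIV)
  ultimately have "(\<lambda>n. qpoch q (q ^ n * w)) \<longlonglongrightarrow> qpoch q 0"
    by (intro isCont_tendsto_compose[where g = "qpoch q"]) simp_all
  moreover have "qpoch q 0 = 1" by (simp add: qpoch_def)
  ultimately show False using zero by (simp add: LIMSEQ_const_iff)
qed

text \<open>With \<open>w = exp (2 * of_real pi * \<i> * x)\<close> and
  \<open>q = exp (2 * of_real pi * \<i> * \<tau>)\<close> this is the Jacobi triple product,
  w^(-1/2) (w; q) (q/w; q) in q-Pochhammer notation, without its constant factor. Here
  \<open>q\<close> is the square of the customary nome.\<close>

definition theta1_product :: "complex \<Rightarrow> complex \<Rightarrow> complex" where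
  "theta1_product \<tau> x = exp (- (of_real pi * \<i> * x)) *
     qpoch (exp (2 * of_real pi * \<i> * \<tau>)) (exp (2 * of_real pi * \<i> * x)) *
     qpoch (exp (2 * of_real pi * \<i> * \<tau>)) (exp (2 * of_real pi * \<i> * (\<tau> - x)))"

section \<open>Quasi-periodicity and zeros of the Jacobi product\<close>

context
  fixes \<tau> q :: complex
  assumes tau: "Im \<tau> > 0"
  defines "q \<equiv> exp (2 * of_real pi * \<i> * \<tau>)"
begin

lemma norm_nome: "norm q < 1"
  using tau by (simp add: q_def)

lemma theta1_product_holomorphic: "theta1_product \<tau> holomorphic_on UNIV"
  unfolding theta1_product_def q_def[symmetric]
  by (intro holomorphic_intros qpoch_compose_holomorphic norm_nome)

lemma theta1_product_add_1: "theta1_product \<tau> (x + 1) = theta1_factor \<tau> 1 0 x * theta1_product \<tau> x"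
proof -
  have 1: "exp (2 * of_real pi * \<i> * (x + 1)) = exp (2 * of_real pi * \<i> * x)"
    by (simp add: ring_distribs exp_add)
  have 2: "exp (2 * of_real pi * \<i> * (\<tau> - (x + 1))) = exp (2 * of_real pi * \<i> * (\<tau> - x))"
    by (simp add: ring_distribs exp_add exp_diff)
  have 3: "exp (- (of_real pi * \<i> * (x + 1))) = - exp (- (of_real pi * \<i> * x))"
    by (simp add: ring_distribs exp_add exp_diff)
  show ?thesis
    unfolding theta1_product_def theta1_factor_def 1 2 3 by (simp add: mult.commute)
qed

text \<open>The translation replaces \<open>w\<close> by \<open>q * w\<close> and
  \<open>q * v\<close> by \<open>v\<close>, where \<open>v\<close> is the inverse of
  \<open>w\<close>. One product gains the factor \<open>1 - v\<close> and the other loses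
  \<open>1 - w\<close>; their quotient is \<open>- v\<close>, which completes the exponential to the
  factor of automorphy of \<open>theta1\<close>.\<close>

lemma theta1_product_add_tau:
  "theta1_product \<tau> (x + \<tau>) = theta1_factor \<tau> 0 1 x * theta1_product \<tau> x"
proof -
  define w where "w = exp (2 * of_real pi * \<i> * x)"
  define v where "v = exp (2 * of_real pi * \<i> * (- x))"
  have vw: "v * w = 1" by (simp add: v_def w_def flip: exp_add)
  have 1: "exp (2 * of_real pi * \<i> * (x + \<tau>)) = q * w"
    "exp (2 * of_real pi * \<i> * (\<tau> - (x + \<tau>))) = v"
    "exp (2 * of_real pi * \<i> * (\<tau> - x)) = q * v"
    by (simp_all add: q_def w_def v_def algebra_simps flip: exp_add)
  have 2: "exp (- (of_real pi * \<i> * (x + \<tau>))) * (- v) = theta1_factor \<tau> 0 1 x * exp (- (of_real pi * \<i> * x))"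
  proof -
    have "- v = exp (- (of_real pi * \<i>)) * v" by (simp add: exp_minus)
    then show ?thesis
      unfolding theta1_factor_def v_def by (simp add: algebra_simps flip: exp_add)
  qed
  have "theta1_product \<tau> (x + \<tau>) = exp (- (of_real pi * \<i> * (x + \<tau>))) * qpoch q (q * w) * qpoch q v"
    unfolding theta1_product_def q_def[symmetric] 1 by simp
  also have "qpoch q v = (1 - v) * qpoch q (q * v)"
    by (rule qpoch_step[OF norm_nome])
  also have "1 - v = - v * (1 - w)"
    using vw by (simp add: algebra_simps)
  also have "exp (- (of_real pi * \<i> * (x + \<tau>))) * qpoch q (q * w) * (- v * (1 - w) * qpoch q (q * v))
    = (exp (- (of_real pi * \<i> * (x + \<tau>))) * (- v)) * ((1 - w) * qpoch q (q * w)) * qpoch q (q * v)"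
    by (simp only: ac_simps)
  also have "(1 - w) * qpoch q (q * w) = qpoch q w"
    by (rule qpoch_step[OF norm_nome, symmetric])
  finally show ?thesis
    unfolding 2 theta1_product_def q_def[symmetric] 1 w_def[symmetric] by simp
qed

text \<open>Taking logarithms in the vanishing factor: the first product accounts for the lattice
  points with nonpositive coefficient of \<open>\<tau>\<close>, the second for those with positive
  coefficient.\<close>

lemma theta1_product_eq_0D:
  assumes "theta1_product \<tau> x = 0"
  shows "\<exists>m n. x = of_int m + of_int n * \<tau>"
proof -
  have lat: "\<exists>m. y = of_int m" if "exp (2 * of_real pi * \<i> * y) = 1" for y
  proof -
    from that obtain m :: int where "Re y * (2 * pi) = of_int (2 * m) * pi" "Im y = 0"
      by (auto simp: exp_eq_1)
    then show ?thesis by (intro exI[of _ m]) (auto simp: complex_eq_iff)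
  qed
  have pow: "q ^ n = exp (2 * of_real pi * \<i> * (of_nat n * \<tau>))" for n
    by (simp add: q_def mult_ac flip: exp_of_nat_mult)
  consider "qpoch q (exp (2 * of_real pi * \<i> * x)) = 0" | "qpoch q (exp (2 * of_real pi * \<i> * (\<tau> - x))) = 0"
    using assms by (auto simp: theta1_product_def q_def)
  then show ?thesis
  proof cases
    case 1
    then obtain n where "q ^ n * exp (2 * of_real pi * \<i> * x) = 1"
      using qpoch_eq_0D norm_nome by blast
    then have "exp (2 * of_real pi * \<i> * (of_nat n * \<tau> + x)) = 1"
      by (simp add: pow algebra_simps flip: exp_add)
    then obtain m where "of_nat n * \<tau> + x = of_int m" using lat by blast
    then have "x = of_int m + of_int (- int n) * \<tau>" by (simp add: algebra_simps)
    then show ?thesis by blast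
  next
    case 2
    then obtain n where "q ^ n * exp (2 * of_real pi * \<i> * (\<tau> - x)) = 1"
      using qpoch_eq_0D norm_nome by blast
    then have "exp (2 * of_real pi * \<i> * (of_nat n * \<tau> + (\<tau> - x))) = 1"
      by (simp add: pow algebra_simps flip: exp_add)
    then obtain m where "of_nat n * \<tau> + (\<tau> - x) = of_int m" using lat by blast
    then have "x = of_int (- m) + of_int (int n + 1) * \<tau>" by (simp add: algebra_simps)
    then show ?thesis by blast
  qed
qed

lemma theta1_product_0: "theta1_product \<tau> 0 = 0"
  using qpoch_step[OF norm_nome, of 1] by (simp add: theta1_product_def q_def)

text \<open>Splitting off \<open>1 - exp (2 * of_real pi * \<i> * x)\<close>, which has a simple
  zero at 0, leaves a cofactor \<open>g\<close> whose value at 0 is the square of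
  \<open>qpoch q q\<close>. This is nonzero because no positive power of \<open>q\<close> is
  1.\<close>

lemma deriv_theta1_product_0: "deriv (theta1_product \<tau>) 0 \<noteq> 0"
proof -
  define g where "g = (\<lambda>x. exp (- (of_real pi * \<i> * x)) * qpoch q (q * exp (2 * of_real pi * \<i> * x))
     * qpoch q (exp (2 * of_real pi * \<i> * (\<tau> - x))))"
  have "g holomorphic_on UNIV"
    unfolding g_def by (intro holomorphic_intros qpoch_compose_holomorphic norm_nome)
  then have g: "(g has_field_derivative deriv g 0) (at 0)"
    by (simp add: holomorphic_derivI)
  have "((\<lambda>x. (1 - exp (2 * of_real pi * \<i> * x)) * g x) has_field_derivative - (2 * of_real pi * \<i>) * g 0) (at 0)"
    by (rule derivative_eq_intros g refl | simp)+
  also have "(\<lambda>x. (1 - exp (2 * of_real pi * \<i> * x)) * g x) = theta1_product \<tau>"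
  proof
    fix x
    show "(1 - exp (2 * of_real pi * \<i> * x)) * g x = theta1_product \<tau> x"
      unfolding theta1_product_def g_def q_def[symmetric]
        qpoch_step[OF norm_nome, of "exp (2 * of_real pi * \<i> * x)"] by (simp only: ac_simps)
  qed
  finally have "deriv (theta1_product \<tau>) 0 = - (2 * of_real pi * \<i>) * g 0"
    by (rule DERIV_imp_deriv)
  moreover have "qpoch q q \<noteq> 0"
    using qpoch_eq_0D[OF norm_nome, of q] power_neq_1[OF norm_nome] by (metis power_Suc2)
  then have "g 0 \<noteq> 0" by (simp add: g_def) (simp add: q_def)
  ultimately show ?thesis by simp
qed

text \<open>
  The quotient of the theta series by the product is elliptic, and entire because the zeros
  of the product are simple and are zeros of the theta series; so it is constant.
\<close>

lemma theta1_eq_const_mult_product: "\<exists>C. \<forall>x. theta1 \<tau> x = C * theta1_product \<tau> x"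
proof -
  define P where "P = theta1_product \<tau>"
  \<comment> \<open>The value at 0 is the limit of the quotient there, by first derivatives. The
    same constant fits every other zero of \<open>P\<close>, since both functions have the same
    factors of automorphy.\<close>
  define H where "H = (\<lambda>x. if P x = 0 then deriv (theta1 \<tau>) 0 / deriv P 0 else theta1 \<tau> x / P x)"
  note holo = theta1_holomorphic[OF tau] theta1_product_holomorphic[folded P_def]
  interpret H1: periodic_fun_simple H 1
  proof
    show "H (x + 1) = H x" for x
      using theta1_add_lattice[of \<tau> x 1 0] theta1_product_add_1[of x]
      by (simp add: H_def P_def)
  qed
  interpret Htau: periodic_fun_simple H \<tau>
  proof
    show "H (x + \<tau>) = H x" for x
      using theta1_add_lattice[of \<tau> x 0 1] theta1_product_add_tau[of x]
      by (simp add: H_def P_def)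
  qed
  have per: "H (x + of_int m + of_int n * \<tau>) = H x" for x m n
    using H1.plus_of_int[of x m] Htau.plus_of_int[of "x + of_int m" n] by simp
  have cont: "continuous_on UNIV P"
    using holo(2) by (rule holomorphic_on_imp_continuous_on)
  have op: "open {x. P x \<noteq> 0}"
    using continuous_open_preimage[OF cont, of "- {0}"] by (simp add: vimage_def open_Compl Collect_neg_eq)
  have "(\<lambda>x. theta1 \<tau> x / P x) holomorphic_on {x. P x \<noteq> 0}"
    by (intro holomorphic_intros) (use holo holomorphic_on_subset in blast)+
  then have "H holomorphic_on {x. P x \<noteq> 0}"
    by (rule holomorphic_transform) (simp add: H_def)
  then have reg: "H field_differentiable (at x)" if "P x \<noteq> 0" for x
    using op that by (simp add: holomorphic_on_imp_differentiable_at)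
  have at0: "H field_differentiable (at 0)"
  proof -
    have P0: "P 0 = 0" by (simp add: P_def theta1_product_0)
    have dP: "(P has_field_derivative deriv P 0) (at 0)"
      and dT: "(theta1 \<tau> has_field_derivative deriv (theta1 \<tau>) 0) (at 0)"
      using holo by (simp_all add: holomorphic_derivI)
    have nz: "deriv P 0 \<noteq> 0" by (simp add: P_def deriv_theta1_product_0)
    have "((\<lambda>h. (theta1 \<tau> h / h) / (P h / h)) \<longlongrightarrow> deriv (theta1 \<tau>) 0 / deriv P 0) (at 0)"
      using dP dT nz P0 by (intro tendsto_divide) (simp_all add: DERIV_def)
    moreover have "\<exists>y. P y \<noteq> 0"
    proof (rule ccontr)
      assume "\<not> ?thesis"
      then have "P = (\<lambda>_. 0)" by auto
      then show False using nz by simp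
    qed
    then have ev: "\<forall>\<^sub>F h in at 0. P h \<noteq> 0"
      using non_zero_neighbour_alt[OF holo(2), of 0] by (auto elim: eventually_mono)
    then have "\<forall>\<^sub>F h in at 0. (theta1 \<tau> h / h) / (P h / h) = H h"
      using eventually_neq_at_within[of 0 0 UNIV] by eventually_elim (simp add: H_def)
    ultimately have lim: "(H \<longlongrightarrow> H 0) (at 0)"
      by (simp add: H_def P0 Lim_transform_eventually)
    obtain r where r: "r > 0" "\<And>h. h \<in> ball 0 r - {0} \<Longrightarrow> P h \<noteq> 0"
      using ev by (auto simp: eventually_at dist_commute)
    \<comment> \<open>Riemann's removable singularity theorem applies, as \<open>H\<close> is
      continuous at 0.\<close>
    have "H holomorphic_on ball 0 r - {0}"
      using reg r(2) by (auto simp: holomorphic_on_def intro: field_differentiable_at_within)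
    then have "H holomorphic_on ball 0 r"
      by (rule no_isolated_singularity'[rotated])
         (use tendsto_within_subset[OF lim, of "ball 0 r"] in auto)
    then show ?thesis
      using r(1) by (simp add: holomorphic_on_imp_differentiable_at)
  qed
  \<comment> \<open>Every zero of \<open>P\<close> is a lattice point, so periodicity moves it to
    0.\<close>
  have "H field_differentiable (at x)" for x
  proof (cases "P x = 0")
    case True
    then obtain m n where x: "x = of_int m + of_int n * \<tau>"
      using theta1_product_eq_0D P_def by blast
    have "(H \<circ> (\<lambda>y. y - x)) field_differentiable (at x)"
      by (rule field_differentiable_compose) (auto intro!: derivative_intros at0)
    moreover have "H \<circ> (\<lambda>y. y - x) = H"
    proof
      fix y show "(H \<circ> (\<lambda>y. y - x)) y = H y"
        using per[of "y - x" m n] by (simp add: x)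
    qed
    ultimately show ?thesis by simp
  qed (rule reg)
  then have holoH: "H holomorphic_on UNIV" by (simp add: holomorphic_on_def)
  \<comment> \<open>The closed period parallelogram: it is compact, so \<open>H\<close> is bounded
    on it, and by periodicity \<open>H\<close> takes all its values there.\<close>
  define K where "K = (\<lambda>(a, b). of_real a + of_real b * \<tau>) ` ({0..1::real} \<times> {0..1::real})"
  have "compact K"
    unfolding K_def case_prod_unfold
    by (intro compact_continuous_image continuous_intros compact_Times compact_Icc)
  then have "bounded (H ` K)"
    by (intro compact_imp_bounded compact_continuous_image
        continuous_on_subset[OF holomorphic_on_imp_continuous_on[OF holoH]]) auto
  moreover have "range H \<subseteq> H ` K"
  proof safe
    fix x
    \<comment> \<open>The real coordinates of \<open>x\<close> in the basis 1,
      \<open>\<tau>\<close>; their fractional parts give a representative in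
      \<open>K\<close>.\<close>
    define b where "b = Im x / Im \<tau>"
    define a where "a = Re x - b * Re \<tau>"
    have x: "x = of_real a + of_real b * \<tau>"
      using tau by (simp add: complex_eq_iff a_def b_def)
    have "H (of_real (frac a) + of_real (frac b) * \<tau>) = H x"
      using per[of "of_real (frac a) + of_real (frac b) * \<tau>" "\<lfloor>a\<rfloor>" "\<lfloor>b\<rfloor>"]
      by (simp add: x frac_def algebra_simps)
    moreover have "of_real (frac a) + of_real (frac b) * \<tau> \<in> K"
      unfolding K_def using frac_ge_0 frac_lt_1
      by (intro image_eqI[of _ _ "(frac a, frac b)"]) (auto intro: less_imp_le)
    ultimately show "H x \<in> H ` K" by (metis imageI)
  qed
  ultimately have "bounded (range H)" by (rule bounded_subset)
  from Liouville_theorem[OF holoH this] obtain C where C: "H x = C" for x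
    by (auto simp: constant_on_def)
  have "theta1 \<tau> x = C * P x" for x
  proof (cases "P x = 0")
    case True
    then obtain m n where x: "x = of_int m + of_int n * \<tau>"
      using theta1_product_eq_0D P_def by blast
    then show ?thesis using True by simp
  next
    case False
    then show ?thesis using C[of x] by (simp add: H_def field_simps)
  qed
  then show ?thesis by (auto simp: P_def)
qed

section \<open>Zeros of the theta series and their simplicity\<close>

context
  fixes y :: complex
  assumes nonzero: "theta1 \<tau> y \<noteq> 0"
begin

text \<open>One point at which \<open>theta1 \<tau>\<close> is nonzero suffices to see that the
  proportionality constant \<open>C\<close> is nonzero, so the constant need not be
  evaluated.\<close>

lemma theta1_eq_0_iff: "theta1 \<tau> x = 0 \<longleftrightarrow> (\<exists>m n. x = of_int m + of_int n * \<tau>)"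
proof
  assume "theta1 \<tau> x = 0"
  moreover obtain C where C: "\<And>x. theta1 \<tau> x = C * theta1_product \<tau> x"
    using theta1_eq_const_mult_product by blast
  moreover have "C \<noteq> 0" using nonzero C by auto
  ultimately have "theta1_product \<tau> x = 0" by simp
  then show "\<exists>m n. x = of_int m + of_int n * \<tau>" by (rule theta1_product_eq_0D)
qed auto

text \<open>The derivative at 0 is transported by quasi-periodicity. The term with the derivative of
  the factor of automorphy drops out because \<open>theta1\<close> vanishes at 0.\<close>

lemma deriv_theta1_lattice: "deriv (theta1 \<tau>) (of_int m + of_int n * \<tau>) \<noteq> 0"
proof -
  obtain C where C: "\<And>x. theta1 \<tau> x = C * theta1_product \<tau> x"
    using theta1_eq_const_mult_product by blast
  define a where "a = of_int m + of_int n * \<tau>"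
  have "theta1 \<tau> = (\<lambda>x. C * theta1_product \<tau> x)" using C by auto
  moreover have "(theta1_product \<tau> has_field_derivative deriv (theta1_product \<tau>) 0) (at 0)"
    using theta1_product_holomorphic by (simp add: holomorphic_derivI)
  ultimately have 0: "(theta1 \<tau> has_field_derivative C * deriv (theta1_product \<tau>) 0) (at 0)"
    by (auto intro!: derivative_eq_intros)
  have "(theta1_factor \<tau> m n has_field_derivative
      theta1_factor \<tau> m n 0 * (of_real pi * \<i> * (- 2 * of_int n))) (at 0)"
    unfolding theta1_factor_def by (auto intro!: derivative_eq_intros)
  from DERIV_mult[OF this 0]
  have "((\<lambda>x. theta1_factor \<tau> m n x * theta1 \<tau> x) has_field_derivative
      theta1_factor \<tau> m n 0 * (C * deriv (theta1_product \<tau>) 0)) (at 0)"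
    by (simp add: mult_ac)
  also have "(\<lambda>x. theta1_factor \<tau> m n x * theta1 \<tau> x) = (\<lambda>x. theta1 \<tau> (x + a))"
    by (simp add: theta1_add_lattice[symmetric] a_def add.assoc)
  finally have "(theta1 \<tau> has_field_derivative theta1_factor \<tau> m n 0 * (C * deriv (theta1_product \<tau>) 0)) (at a)"
    using DERIV_shift[of "theta1 \<tau>" _ 0 a] by simp
  then have "deriv (theta1 \<tau>) a = theta1_factor \<tau> m n 0 * (C * deriv (theta1_product \<tau>) 0)"
    by (rule DERIV_imp_deriv)
  moreover have "C \<noteq> 0" using nonzero C by auto
  ultimately show ?thesis by (simp add: deriv_theta1_product_0 a_def)
qed

lemma deriv_theta1_at_zero: "theta1 \<tau> a = 0 \<Longrightarrow> deriv (theta1 \<tau>) a \<noteq> 0"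
  using theta1_eq_0_iff deriv_theta1_lattice by auto

end

end

section \<open>Sums, shifts and logarithmic derivatives\<close>

lemma residue_sum:
  assumes "open S" and "z \<in> S" and "finite J"
    and "\<And>j. j \<in> J \<Longrightarrow> f j holomorphic_on S - {z}"
  shows "residue (\<lambda>w. \<Sum>j\<in>J. f j w) z = (\<Sum>j\<in>J. residue (f j) z)"
  using assms(3,4)
proof (induction J rule: finite_induct)
  case empty
  show ?case by (simp add: residue_const)
next
  case (insert a J)
  have "residue (\<lambda>w. f a w + (\<Sum>j\<in>J. f j w)) z = residue (f a) z + residue (\<lambda>w. \<Sum>j\<in>J. f j w) z"
    by (intro residue_add[OF assms(1,2)] holomorphic_intros) (use insert in auto)
  then show ?case using insert by simp
qed

lemma residue_shift: "residue (\<lambda>w. f (w + a)) z = residue f (z + a)"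
  by (subst (1 2) residue_shift_0) (simp add: ac_simps)

text \<open>Derivatives are kept in the form \<open>f t * a\<close>, with \<open>a\<close> the
  logarithmic derivative, so that products add the \<open>a\<close> and inverses negate
  them.\<close>

lemma has_vector_derivative_mult_log:
  fixes f g :: "real \<Rightarrow> complex"
  assumes "(f has_vector_derivative f t * a) (at t)" and "(g has_vector_derivative g t * b) (at t)"
  shows "((\<lambda>s. f s * g s) has_vector_derivative f t * g t * (a + b)) (at t)"
  using has_vector_derivative_mult[OF assms] by (simp add: algebra_simps)

lemma has_vector_derivative_inverse_log:
  fixes f :: "real \<Rightarrow> complex"
  assumes "(f has_vector_derivative f t * a) (at t)" and "f t \<noteq> 0"
  shows "((\<lambda>s. inverse (f s)) has_vector_derivative inverse (f t) * (- a)) (at t)"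
proof -
  have "(inverse has_field_derivative - (inverse (f t) ^ Suc (Suc 0))) (at (f t))"
    by (rule DERIV_inverse) (use assms in simp)
  from field_vector_diff_chain_at[OF assms(1) this] show ?thesis
    using assms(2) by (simp add: o_def field_simps)
qed

lemma has_vector_derivative_prod_log:
  fixes f :: "'a \<Rightarrow> real \<Rightarrow> complex"
  assumes "finite J" and "\<And>j. j \<in> J \<Longrightarrow> (f j has_vector_derivative f j t * a j) (at t)"
  shows "((\<lambda>s. \<Prod>j\<in>J. f j s) has_vector_derivative (\<Prod>j\<in>J. f j t) * (\<Sum>j\<in>J. a j)) (at t)"
  using assms
proof (induction J rule: finite_induct)
  case (insert i J)
  then show ?case
    using has_vector_derivative_mult_log[of "f i" t "a i" "\<lambda>s. \<Prod>j\<in>J. f j s"] by simp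
qed simp

section \<open>Residues of the pole ansatz\<close>

lemma rho_eq_0_iff: "rho \<tau> N X z = 0 \<longleftrightarrow> (\<exists>j\<in>{1..N}. theta1 \<tau> (z - X j) = 0)"
  by (auto simp: rho_def)

lemma rho_add_lattice:
  "rho \<tau> N X (z + of_int m + of_int n * \<tau>) = (\<Prod>j=1..N. theta1_factor \<tau> m n (z - X j)) * rho \<tau> N X z"
proof -
  have "theta1 \<tau> (z + of_int m + of_int n * \<tau> - X j) = theta1_factor \<tau> m n (z - X j) * theta1 \<tau> (z - X j)" for j
    using theta1_add_lattice[of \<tau> "z - X j" m n] by (simp add: algebra_simps)
  then show ?thesis by (simp add: rho_def prod.distrib)
qed

text \<open>The exponent of the factor of automorphy is affine in the argument, and the shifts
  \<open>\<eta>\<close>, \<open>- 2 * \<eta>\<close> of the numerator have the same sum as the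
  shifts 0, \<open>- \<eta>\<close> of the denominator. Hence all factors cancel.\<close>

lemma pole_ansatz_add_lattice:
  "pole_ansatz \<tau> \<eta> N X (z + of_int m + of_int n * \<tau>) = pole_ansatz \<tau> \<eta> N X z"
proof -
  define F where "F = (\<lambda>z. \<Prod>j=1..N. theta1_factor \<tau> m n (z - X j))"
  have F: "F (z + \<eta>) * F (z - 2 * \<eta>) = F z * F (z - \<eta>)"
  proof -
    have "theta1_factor \<tau> m n (z + \<eta> - X j) * theta1_factor \<tau> m n (z - 2 * \<eta> - X j)
        = theta1_factor \<tau> m n (z - X j) * theta1_factor \<tau> m n (z - \<eta> - X j)" for j
      unfolding theta1_factor_def exp_add[symmetric] by (rule arg_cong[of _ _ exp]) (simp add: algebra_simps)
    then show ?thesis by (simp add: F_def flip: prod.distrib)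
  qed
  have nz: "F z * F (z - \<eta>) \<noteq> 0" by (simp add: F_def)
  have shift: "rho \<tau> N X (z + of_int m + of_int n * \<tau> + s) = F (z + s) * rho \<tau> N X (z + s)" for s
    using rho_add_lattice[of \<tau> N X "z + s" m n] by (simp add: F_def ac_simps)
  have "pole_ansatz \<tau> \<eta> N X (z + of_int m + of_int n * \<tau>)
     = ((F (z + \<eta>) * F (z - 2 * \<eta>)) * (rho \<tau> N X (z + \<eta>) * rho \<tau> N X (z - 2 * \<eta>)))
       / ((F z * F (z - \<eta>)) * (rho \<tau> N X z * rho \<tau> N X (z - \<eta>)))"
    using shift[of \<eta>] shift[of "- 2 * \<eta>"] shift[of 0] shift[of "- \<eta>"]
    by (simp add: pole_ansatz_def mult_ac)
  also have "\<dots> = pole_ansatz \<tau> \<eta> N X z"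
    unfolding F using nz by (simp add: pole_ansatz_def)
  finally show ?thesis .
qed

text \<open>As a complex number, since it serves as the residue of the logarithmic derivative of
  \<open>theta1\<close>. It lets residue formulas be written as one sum valid at every
  point.\<close>

definition theta1_zero :: "complex \<Rightarrow> complex \<Rightarrow> complex" where
  "theta1_zero \<tau> u = of_bool (theta1 \<tau> u = 0)"

lemma theta1_zero_add_lattice: "theta1_zero \<tau> (u + of_int m + of_int n * \<tau>) = theta1_zero \<tau> u"
  by (simp add: theta1_zero_def theta1_add_lattice)

text \<open>The cofactor of \<open>theta1 \<tau> s\<close> in the value of \<open>rho\<close> at
  \<open>X j + s\<close>; both systems and the locus equations are quotients of such values.\<close>

definition config_prod :: "complex \<Rightarrow> nat \<Rightarrow> (nat \<Rightarrow> complex) \<Rightarrow> nat \<Rightarrow> complex \<Rightarrow> complex" where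
  "config_prod \<tau> N X j s = (\<Prod>k\<in>{1..N} - {j}. theta1 \<tau> (X j - X k + s))"

lemma system_rhs_eq_config_prod:
  fixes \<tau> N X j
  defines "R \<equiv> config_prod \<tau> N X j"
  shows "system1_rhs \<tau> \<eta> N X j = R (2 * \<eta>) * R (- \<eta>) / (R \<eta> * R 0)"
    and "system2_rhs \<tau> \<eta> N X j = R (- 2 * \<eta>) * R \<eta> / (R (- \<eta>) * R 0)"
  by (simp_all add: system1_rhs_def system2_rhs_def R_def config_prod_def prod_dividef prod.distrib)

lemma rho_at_point:
  assumes "j \<in> {1..N}"
  shows "rho \<tau> N X (X j + s) = theta1 \<tau> s * config_prod \<tau> N X j s"
  using assms unfolding config_prod_def
  by (subst rho_def, subst prod.remove[of _ j]) (simp_all add: algebra_simps)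

text \<open>The first system solved for dx_j/dt. Up to sign it is also the residue of the pole
  ansatz at \<open>X j + \<eta>\<close>.\<close>

definition velocity1 :: "complex \<Rightarrow> complex \<Rightarrow> nat \<Rightarrow> (nat \<Rightarrow> complex) \<Rightarrow> nat \<Rightarrow> complex" where
  "velocity1 \<tau> \<eta> N X j = theta1 \<tau> (2 * \<eta>) / deriv (theta1 \<tau>) 0 * system1_rhs \<tau> \<eta> N X j"

definition velocity2 :: "complex \<Rightarrow> complex \<Rightarrow> nat \<Rightarrow> (nat \<Rightarrow> complex) \<Rightarrow> nat \<Rightarrow> complex" where
  "velocity2 \<tau> \<eta> N X j = theta1 \<tau> (2 * \<eta>) / deriv (theta1 \<tau>) 0 * system2_rhs \<tau> \<eta> N X j"

context
  fixes \<tau> \<eta> :: complex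
  assumes tau: "Im \<tau> > 0" and eta: "theta1 \<tau> \<eta> \<noteq> 0" and eta2: "theta1 \<tau> (2 * \<eta>) \<noteq> 0"
begin

lemma theta1_compose_holomorphic:
  "g holomorphic_on A \<Longrightarrow> (\<lambda>z. theta1 \<tau> (g z)) holomorphic_on A"
  using holomorphic_on_compose_gen[of g A "theta1 \<tau>" UNIV] theta1_holomorphic[OF tau] by (simp add: o_def)

lemma deriv_theta1_compose_holomorphic:
  "g holomorphic_on A \<Longrightarrow> (\<lambda>z. deriv (theta1 \<tau>) (g z)) holomorphic_on A"
  using holomorphic_on_compose_gen[of g A "deriv (theta1 \<tau>)" UNIV]
    holomorphic_deriv[OF theta1_holomorphic[OF tau]] by (simp add: o_def)

lemma theta1_has_field_derivative: "(theta1 \<tau> has_field_derivative deriv (theta1 \<tau>) u) (at u)"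
  using theta1_holomorphic[OF tau] by (simp add: holomorphic_derivI)

lemma rho_compose_holomorphic:
  "g holomorphic_on A \<Longrightarrow> (\<lambda>z. rho \<tau> N X (g z)) holomorphic_on A"
  unfolding rho_def by (intro holomorphic_intros theta1_compose_holomorphic)

lemma eventually_rho_neq_0: "\<forall>\<^sub>F z in at z0. rho \<tau> N X (z + s) \<noteq> 0"
proof -
  have "\<forall>\<^sub>F z in at z0. theta1 \<tau> (z + s - a) \<noteq> 0" for a
  proof -
    have "\<forall>\<^sub>F z in at z0. theta1 \<tau> (z + s - a) \<noteq> 0 \<and> z \<in> UNIV"
      \<comment> \<open>At this point the argument of \<open>theta1\<close> is
        \<open>\<eta>\<close>, so the function is not identically zero and its zeros are
        isolated.\<close>
      by (rule non_zero_neighbour_alt[where \<beta> = "\<eta> - s + a"])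
         (use eta in \<open>auto intro!: theta1_compose_holomorphic holomorphic_intros\<close>)
    then show ?thesis by simp
  qed
  then have "\<forall>\<^sub>F z in at z0. \<forall>j\<in>{1..N}. theta1 \<tau> (z + s - X j) \<noteq> 0"
    by (intro eventually_ball_finite) auto
  then show ?thesis by eventually_elim (auto simp: rho_eq_0_iff)
qed

text \<open>All zeros of \<open>theta1\<close> are simple, so each of them gives residue 1.\<close>

lemma residue_theta1_log_deriv:
  "residue (\<lambda>z. deriv (theta1 \<tau>) (z - a) / theta1 \<tau> (z - a)) z0 = theta1_zero \<tau> (z0 - a)"
proof (cases "theta1 \<tau> (z0 - a) = 0")
  case True
  have "residue (\<lambda>z. deriv (theta1 \<tau>) (z - a) / theta1 \<tau> (z - a)) z0
      = deriv (theta1 \<tau>) (z0 - a) / deriv (theta1 \<tau>) (z0 - a)"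
  proof (rule residue_simple_pole_deriv[where s = UNIV])
    show "((\<lambda>z. theta1 \<tau> (z - a)) has_field_derivative deriv (theta1 \<tau>) (z0 - a)) (at z0)"
      using DERIV_shift[of "theta1 \<tau>" _ z0 "- a"] theta1_has_field_derivative[of "z0 - a"] by simp
  qed (use True deriv_theta1_at_zero[OF tau eta True] in
      \<open>auto intro!: theta1_compose_holomorphic deriv_theta1_compose_holomorphic holomorphic_intros\<close>)
  then show ?thesis
    using True deriv_theta1_at_zero[OF tau eta True] by (simp add: theta1_zero_def)
next
  case False
  have holo: "(\<lambda>z. theta1 \<tau> (z - a)) holomorphic_on UNIV"
    by (intro theta1_compose_holomorphic holomorphic_intros)
  have "open ((\<lambda>z. theta1 \<tau> (z - a)) -` (- {0}))"
    using holomorphic_on_imp_continuous_on[OF holo] by (auto intro: open_vimage)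
  then have "residue (\<lambda>z. deriv (theta1 \<tau>) (z - a) / theta1 \<tau> (z - a)) z0 = 0"
    by (rule residue_holo)
       (use False in \<open>auto intro!: theta1_compose_holomorphic deriv_theta1_compose_holomorphic holomorphic_intros\<close>)
  then show ?thesis using False by (simp add: theta1_zero_def)
qed

lemma residue_pole_ansatz_add_lattice:
  "residue (pole_ansatz \<tau> \<eta> N X) (z + (of_int m + of_int n * \<tau>)) = residue (pole_ansatz \<tau> \<eta> N X) z"
  by (subst residue_shift[symmetric]) (simp add: pole_ansatz_add_lattice flip: add.assoc)

text \<open>In the product rule only the term that differentiates the factor with index
  \<open>j\<close> survives, as this factor vanishes at \<open>X j\<close>.\<close>

lemma rho_has_field_derivative_at_point:
  assumes "j \<in> {1..N}"
  shows "(rho \<tau> N X has_field_derivative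
      deriv (theta1 \<tau>) 0 * config_prod \<tau> N X j 0) (at (X j))"
proof -
  define R where "R = (\<lambda>z. \<Prod>k\<in>{1..N} - {j}. theta1 \<tau> (z - X k))"
  have "R holomorphic_on UNIV"
    unfolding R_def by (intro holomorphic_intros theta1_compose_holomorphic)
  then have "(R has_field_derivative deriv R (X j)) (at (X j))"
    by (simp add: holomorphic_derivI)
  moreover have "((\<lambda>z. theta1 \<tau> (z - X j)) has_field_derivative deriv (theta1 \<tau>) 0) (at (X j))"
    using DERIV_shift[of "theta1 \<tau>" _ "X j" "- X j"] theta1_has_field_derivative[of 0] by simp
  ultimately have "((\<lambda>z. theta1 \<tau> (z - X j) * R z) has_field_derivative deriv (theta1 \<tau>) 0 * R (X j)) (at (X j))"
    using DERIV_mult by fastforce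
  moreover have "(\<lambda>z. theta1 \<tau> (z - X j) * R z) = rho \<tau> N X"
    using assms by (auto simp: rho_def R_def prod.remove[of _ j])
  ultimately show ?thesis by (simp add: R_def config_prod_def)
qed

section \<open>Residues of the pole ansatz for a nondegenerate configuration\<close>

context
  fixes N :: nat and X :: "nat \<Rightarrow> complex"
  assumes nondeg: "nondegenerate \<tau> \<eta> N X"
begin

lemmas theta1_distinct_neq_0 = nondeg[unfolded nondegenerate_def, rule_format]

text \<open>Nondegeneracy speaks of distinct indices only; for equal ones the genericity of
  \<open>\<eta>\<close> is used.\<close>

lemma theta1_config_neq_0:
  assumes "j \<in> {1..N}" "k \<in> {1..N}" and "s \<in> {\<eta>, - \<eta>, 2 * \<eta>, - 2 * \<eta>}"
  shows "theta1 \<tau> (X j - X k + s) \<noteq> 0"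
proof (cases "j = k")
  case True
  then show ?thesis
    using assms(3) eta eta2 theta1_minus[of \<tau> \<eta>] theta1_minus[of \<tau> "2 * \<eta>"] by auto
next
  case False
  show ?thesis by (rule theta1_distinct_neq_0) (use assms False in auto)
qed

text \<open>These values collapse the sums over \<open>k\<close> in the residue formulas to the
  single term \<open>k = j\<close>.\<close>

lemma theta1_zero_config:
  assumes "j \<in> {1..N}" "k \<in> {1..N}"
  shows "theta1_zero \<tau> (X j - X k) = of_bool (k = j)"
    and "theta1_zero \<tau> (X j - X k + \<eta>) = 0" and "theta1_zero \<tau> (X j - X k - \<eta>) = 0"
    and "theta1_zero \<tau> (X j - X k + 2 * \<eta>) = 0" and "theta1_zero \<tau> (X j - X k - 2 * \<eta>) = 0"
proof -
  show "theta1_zero \<tau> (X j - X k) = of_bool (k = j)"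
  proof (cases "j = k")
    case False
    have "theta1 \<tau> (X j - X k + 0) \<noteq> 0"
      by (rule theta1_distinct_neq_0) (use assms False in auto)
    then show ?thesis using False by (simp add: theta1_zero_def)
  qed (simp add: theta1_zero_def)
qed (use theta1_config_neq_0[OF assms, of \<eta>] theta1_config_neq_0[OF assms, of "- \<eta>"]
      theta1_config_neq_0[OF assms, of "2 * \<eta>"] theta1_config_neq_0[OF assms, of "- 2 * \<eta>"]
    in \<open>simp_all add: theta1_zero_def\<close>)

lemma config_prod_neq_0:
  assumes "j \<in> {1..N}" and "s \<in> {0, \<eta>, - \<eta>, 2 * \<eta>, - 2 * \<eta>}"
  shows "config_prod \<tau> N X j s \<noteq> 0"
proof -
  have "theta1 \<tau> (X j - X k + s) \<noteq> 0" if "k \<in> {1..N} - {j}" for k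
    by (rule theta1_distinct_neq_0) (use assms that in auto)
  then show ?thesis by (simp add: config_prod_def)
qed

text \<open>At a simple pole the residue is the numerator over the derivative of the denominator.
  Oddness of \<open>theta1\<close> produces two signs at \<open>X j\<close>, which cancel, and one
  at \<open>X j + \<eta>\<close>.\<close>

lemma residue_pole_ansatz_at_point:
  assumes j: "j \<in> {1..N}"
  shows "residue (pole_ansatz \<tau> \<eta> N X) (X j) = velocity2 \<tau> \<eta> N X j"
    and "residue (pole_ansatz \<tau> \<eta> N X) (X j + \<eta>) = - velocity1 \<tau> \<eta> N X j"
proof -
  define R where "R = config_prod \<tau> N X j"
  have R: "R 0 \<noteq> 0" "R \<eta> \<noteq> 0" "R (- \<eta>) \<noteq> 0" "R (2 * \<eta>) \<noteq> 0" "R (- 2 * \<eta>) \<noteq> 0"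
    unfolding R_def by (rule config_prod_neq_0[OF j]; simp)+
  have rho: "rho \<tau> N X (X j + s) = theta1 \<tau> s * R s" for s
    unfolding R_def by (rule rho_at_point[OF j])
  note d0 = deriv_theta1_at_zero[OF tau eta theta1_0]
  have drho: "(rho \<tau> N X has_field_derivative deriv (theta1 \<tau>) 0 * R 0) (at (X j))"
    unfolding R_def by (rule rho_has_field_derivative_at_point[OF j])
  note sys = system_rhs_eq_config_prod[where j = j and X = X and N = N and \<tau> = \<tau> and \<eta> = \<eta>, folded R_def]
  define f where "f = (\<lambda>z. rho \<tau> N X (z + \<eta>) * rho \<tau> N X (z - 2 * \<eta>))"
  define g where "g = (\<lambda>z. rho \<tau> N X z * rho \<tau> N X (z - \<eta>))"
  have holo: "f holomorphic_on UNIV" "g holomorphic_on UNIV"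
    unfolding f_def g_def by (intro holomorphic_intros rho_compose_holomorphic)+
  have fg: "pole_ansatz \<tau> \<eta> N X = (\<lambda>z. f z / g z)"
    by (auto simp: pole_ansatz_def f_def g_def)
  have rho_diff: "(rho \<tau> N X has_field_derivative deriv (rho \<tau> N X) z) (at z)" for z
    using rho_compose_holomorphic[of "\<lambda>z. z" UNIV N X] by (simp add: holomorphic_derivI)
  have val: "rho \<tau> N X (X j) = 0" "rho \<tau> N X (X j + \<eta>) = theta1 \<tau> \<eta> * R \<eta>"
    "rho \<tau> N X (X j - \<eta>) = - theta1 \<tau> \<eta> * R (- \<eta>)"
    "rho \<tau> N X (X j + 2 * \<eta>) = theta1 \<tau> (2 * \<eta>) * R (2 * \<eta>)"
    "rho \<tau> N X (X j - 2 * \<eta>) = - theta1 \<tau> (2 * \<eta>) * R (- 2 * \<eta>)"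
    using rho[of 0] rho[of \<eta>] rho[of "- \<eta>"] rho[of "2 * \<eta>"] rho[of "- 2 * \<eta>"] by (simp_all add: theta1_minus)
  have "(g has_field_derivative deriv (theta1 \<tau>) 0 * R 0 * rho \<tau> N X (X j - \<eta>)) (at (X j))"
  proof -
    have "((\<lambda>z. rho \<tau> N X (z - \<eta>)) has_field_derivative deriv (rho \<tau> N X) (X j - \<eta>)) (at (X j))"
      using DERIV_shift[of "rho \<tau> N X" _ "X j" "- \<eta>"] rho_diff[of "X j - \<eta>"] by simp
    from DERIV_mult[OF drho this] show ?thesis by (simp add: g_def val)
  qed
  then have "residue (\<lambda>z. f z / g z) (X j) = f (X j) / (deriv (theta1 \<tau>) 0 * R 0 * rho \<tau> N X (X j - \<eta>))"
    by (rule residue_simple_pole_deriv[OF holo open_UNIV connected_UNIV UNIV_I])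
       (use R eta eta2 d0 in \<open>auto simp: f_def g_def val\<close>)
  then show "residue (pole_ansatz \<tau> \<eta> N X) (X j) = velocity2 \<tau> \<eta> N X j"
    using eta unfolding fg f_def val velocity2_def sys by (simp add: mult_ac)
  have "(g has_field_derivative deriv (theta1 \<tau>) 0 * R 0 * rho \<tau> N X (X j + \<eta>)) (at (X j + \<eta>))"
  proof -
    have "((\<lambda>z. rho \<tau> N X (z - \<eta>)) has_field_derivative deriv (theta1 \<tau>) 0 * R 0) (at (X j + \<eta>))"
      using DERIV_shift[of "rho \<tau> N X" _ "X j + \<eta>" "- \<eta>"] drho by simp
    from DERIV_mult[OF rho_diff this] show ?thesis by (simp add: g_def val)
  qed
  then have "residue (\<lambda>z. f z / g z) (X j + \<eta>)
      = f (X j + \<eta>) / (deriv (theta1 \<tau>) 0 * R 0 * rho \<tau> N X (X j + \<eta>))"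
    by (rule residue_simple_pole_deriv[OF holo open_UNIV connected_UNIV UNIV_I])
       (use R eta eta2 d0 in \<open>auto simp: f_def g_def val add.assoc simp flip: mult_2\<close>)
  moreover have "f (X j + \<eta>) = rho \<tau> N X (X j + 2 * \<eta>) * rho \<tau> N X (X j - \<eta>)"
    by (simp add: f_def algebra_simps)
  ultimately show "residue (pole_ansatz \<tau> \<eta> N X) (X j + \<eta>) = - velocity1 \<tau> \<eta> N X j"
    using eta unfolding fg val velocity1_def sys by (simp add: mult_ac)
qed

text \<open>Both sides are periodic with respect to the lattice. So it is enough to compare them at
  \<open>X j\<close>, at \<open>X j + \<eta>\<close> and at points where the denominator does not
  vanish.\<close>

lemma residue_pole_ansatz:
  "residue (pole_ansatz \<tau> \<eta> N X) z =
     (\<Sum>j=1..N. velocity2 \<tau> \<eta> N X j * theta1_zero \<tau> (z - X j) - velocity1 \<tau> \<eta> N X j * theta1_zero \<tau> (z - \<eta> - X j))"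
  (is "_ = ?G z")
proof -
  have per: "?G (z + (of_int m + of_int n * \<tau>)) = ?G z" for z m n
  proof -
    have "theta1_zero \<tau> (z + (of_int m + of_int n * \<tau>) - X j) = theta1_zero \<tau> (z - X j)"
      "theta1_zero \<tau> (z + (of_int m + of_int n * \<tau>) - \<eta> - X j) = theta1_zero \<tau> (z - \<eta> - X j)" for j
      using theta1_zero_add_lattice[of \<tau> "z - X j" m n] theta1_zero_add_lattice[of \<tau> "z - \<eta> - X j" m n]
      by (simp_all add: algebra_simps)
    then show ?thesis by simp
  qed
  have sum_delta: "(\<Sum>k=1..N. f k * of_bool (k = j)) = f j" if "j \<in> {1..N}" for f :: "nat \<Rightarrow> complex" and j
    using that by (simp add: of_bool_def if_distrib cong: if_cong)
  consider (pole) j where "j \<in> {1..N}" "theta1 \<tau> (z - X j) = 0"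
    | (shifted) j where "j \<in> {1..N}" "theta1 \<tau> (z - \<eta> - X j) = 0"
    | (regular) "rho \<tau> N X z \<noteq> 0" "rho \<tau> N X (z - \<eta>) \<noteq> 0"
    unfolding rho_eq_0_iff by blast
  then show ?thesis
  proof cases
    case pole
    then obtain m n where "z - X j = of_int m + of_int n * \<tau>"
      using theta1_eq_0_iff[OF tau eta] by blast
    then have z: "z = X j + (of_int m + of_int n * \<tau>)" by (simp add: algebra_simps)
    have "?G (X j) = (\<Sum>k=1..N. velocity2 \<tau> \<eta> N X k * of_bool (k = j))"
    proof (rule sum.cong)
      fix k assume "k \<in> {1..N}"
      then show "velocity2 \<tau> \<eta> N X k * theta1_zero \<tau> (X j - X k) - velocity1 \<tau> \<eta> N X k * theta1_zero \<tau> (X j - \<eta> - X k)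
          = velocity2 \<tau> \<eta> N X k * of_bool (k = j)"
        using theta1_zero_config[OF pole(1), of k] by (simp add: diff_diff_eq add.commute)
    qed simp
    also have "\<dots> = velocity2 \<tau> \<eta> N X j" by (rule sum_delta[OF pole(1)])
    finally show ?thesis
      unfolding z per residue_pole_ansatz_add_lattice
      using residue_pole_ansatz_at_point(1)[OF pole(1)] by simp
  next
    case shifted
    then obtain m n where "z - \<eta> - X j = of_int m + of_int n * \<tau>"
      using theta1_eq_0_iff[OF tau eta] by blast
    then have z: "z = X j + \<eta> + (of_int m + of_int n * \<tau>)" by (simp add: algebra_simps)
    have "?G (X j + \<eta>) = (\<Sum>k=1..N. - velocity1 \<tau> \<eta> N X k * of_bool (k = j))"
    proof (rule sum.cong)
      fix k assume "k \<in> {1..N}"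
      then show "velocity2 \<tau> \<eta> N X k * theta1_zero \<tau> (X j + \<eta> - X k) - velocity1 \<tau> \<eta> N X k * theta1_zero \<tau> (X j + \<eta> - \<eta> - X k)
          = - velocity1 \<tau> \<eta> N X k * of_bool (k = j)"
        using theta1_zero_config[OF shifted(1), of k] by (simp add: add_diff_eq diff_add_eq)
    qed simp
    also have "\<dots> = - velocity1 \<tau> \<eta> N X j" by (rule sum_delta[OF shifted(1)])
    finally show ?thesis
      unfolding z per residue_pole_ansatz_add_lattice
      using residue_pole_ansatz_at_point(2)[OF shifted(1)] by simp
  next
    case regular
    define g where "g = (\<lambda>z. rho \<tau> N X z * rho \<tau> N X (z - \<eta>))"
    have holo: "g holomorphic_on UNIV"
      unfolding g_def by (intro holomorphic_intros rho_compose_holomorphic)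
    have "open (g -` (- {0}))"
      using holomorphic_on_imp_continuous_on[OF holo] by (auto intro: open_vimage)
    then have "residue (pole_ansatz \<tau> \<eta> N X) z = 0"
      by (rule residue_holo)
         (use regular in \<open>auto simp: g_def pole_ansatz_def[abs_def]
           intro!: rho_compose_holomorphic holomorphic_intros\<close>)
    moreover have "?G z = 0"
      using regular by (intro sum.neutral) (auto simp: rho_eq_0_iff theta1_zero_def)
    ultimately show ?thesis by simp
  qed
qed

end

section \<open>Residues of the Volterra defect\<close>

context
  fixes N :: nat and x :: "nat \<Rightarrow> real \<Rightarrow> complex" and t :: real and v :: "nat \<Rightarrow> complex"
  assumes deriv_x: "\<And>j. j \<in> {1..N} \<Longrightarrow> (x j has_vector_derivative v j) (at t)"
begin

lemma rho_has_vector_derivative: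
  assumes "rho \<tau> N (\<lambda>j. x j t) z \<noteq> 0"
  shows "((\<lambda>s. rho \<tau> N (\<lambda>j. x j s) z) has_vector_derivative rho \<tau> N (\<lambda>j. x j t) z *
      (\<Sum>j=1..N. - v j * (deriv (theta1 \<tau>) (z - x j t) / theta1 \<tau> (z - x j t)))) (at t)"
  unfolding rho_def
proof (rule has_vector_derivative_prod_log)
  fix j assume j: "j \<in> {1..N}"
  have "((\<lambda>s. z - x j s) has_vector_derivative - v j) (at t)"
    by (auto intro!: derivative_eq_intros deriv_x[OF j])
  from field_vector_diff_chain_at[OF this theta1_has_field_derivative]
  show "((\<lambda>s. theta1 \<tau> (z - x j s)) has_vector_derivative theta1 \<tau> (z - x j t) *
      (- v j * (deriv (theta1 \<tau>) (z - x j t) / theta1 \<tau> (z - x j t)))) (at t)"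
    using assms j by (auto simp: o_def rho_eq_0_iff)
qed simp

text \<open>The time derivative of \<open>c\<close>, divided by \<open>c\<close>. As
  \<open>x j\<close> enters with a minus sign, the denominator factors of \<open>c\<close>
  contribute with plus and the numerator factors with minus.\<close>

definition ansatz_log_deriv :: "complex \<Rightarrow> complex" where
  "ansatz_log_deriv z = (\<Sum>j=1..N. v j *
     (deriv (theta1 \<tau>) (z - x j t) / theta1 \<tau> (z - x j t)
      + deriv (theta1 \<tau>) (z - (\<eta> + x j t)) / theta1 \<tau> (z - (\<eta> + x j t))
      - deriv (theta1 \<tau>) (z - (x j t - \<eta>)) / theta1 \<tau> (z - (x j t - \<eta>))
      - deriv (theta1 \<tau>) (z - (2 * \<eta> + x j t)) / theta1 \<tau> (z - (2 * \<eta> + x j t))))"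

text \<open>These are the denominators of \<open>c(z)\<close>, \<open>c(z + \<eta>)\<close> and
  \<open>c(z - \<eta>)\<close>. They include the numerator factors of \<open>c(z)\<close>, so
  \<open>c(z)\<close> is nonzero and may be divided by.\<close>

definition regular_point :: "complex \<Rightarrow> bool" where
  "regular_point z \<longleftrightarrow> rho \<tau> N (\<lambda>j. x j t) z \<noteq> 0 \<and> rho \<tau> N (\<lambda>j. x j t) (z + \<eta>) \<noteq> 0 \<and>
     rho \<tau> N (\<lambda>j. x j t) (z - \<eta>) \<noteq> 0 \<and> rho \<tau> N (\<lambda>j. x j t) (z - 2 * \<eta>) \<noteq> 0"

lemma eventually_regular_point: "\<forall>\<^sub>F z in at z0. regular_point z"
  using eventually_rho_neq_0[of N "\<lambda>j. x j t" 0 z0] eventually_rho_neq_0[of N "\<lambda>j. x j t" \<eta> z0]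
    eventually_rho_neq_0[of N "\<lambda>j. x j t" "- \<eta>" z0] eventually_rho_neq_0[of N "\<lambda>j. x j t" "- 2 * \<eta>" z0]
  by eventually_elim (simp add: regular_point_def)

lemma regular_pointD:
  assumes "regular_point z" and "j \<in> {1..N}"
  shows "theta1 \<tau> (z - x j t) \<noteq> 0" and "theta1 \<tau> (z - (\<eta> + x j t)) \<noteq> 0"
    and "theta1 \<tau> (z - (x j t - \<eta>)) \<noteq> 0" and "theta1 \<tau> (z - (2 * \<eta> + x j t)) \<noteq> 0"
  using assms unfolding regular_point_def rho_eq_0_iff by (auto simp: algebra_simps)

lemma pole_ansatz_has_vector_derivative:
  assumes "regular_point z"
  shows "((\<lambda>s. pole_ansatz \<tau> \<eta> N (\<lambda>j. x j s) z) has_vector_derivative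
      pole_ansatz \<tau> \<eta> N (\<lambda>j. x j t) z * ansatz_log_deriv z) (at t)"
proof -
  define a where "a = (\<lambda>z. \<Sum>j=1..N. - v j * (deriv (theta1 \<tau>) (z - x j t) / theta1 \<tau> (z - x j t)))"
  define r where "r = (\<lambda>z s. rho \<tau> N (\<lambda>j. x j s) z)"
  have nz: "r z t \<noteq> 0" "r (z + \<eta>) t \<noteq> 0" "r (z - \<eta>) t \<noteq> 0" "r (z - 2 * \<eta>) t \<noteq> 0"
    using assms by (simp_all add: regular_point_def r_def)
  have d: "(r w has_vector_derivative r w t * a w) (at t)" if "r w t \<noteq> 0" for w
    using rho_has_vector_derivative that unfolding r_def a_def by simp
  have "((\<lambda>s. r (z + \<eta>) s * r (z - 2 * \<eta>) s * inverse (r z s * r (z - \<eta>) s)) has_vector_derivative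
    r (z + \<eta>) t * r (z - 2 * \<eta>) t * inverse (r z t * r (z - \<eta>) t) *
      (a (z + \<eta>) + a (z - 2 * \<eta>) + - (a z + a (z - \<eta>)))) (at t)"
    using nz by (intro has_vector_derivative_mult_log has_vector_derivative_inverse_log d) simp_all
  moreover have "a (z + \<eta>) + a (z - 2 * \<eta>) + - (a z + a (z - \<eta>)) = ansatz_log_deriv z"
    unfolding a_def ansatz_log_deriv_def
    by (simp add: sum_negf[symmetric] sum.distrib[symmetric] algebra_simps)
  ultimately show ?thesis
    by (simp add: pole_ansatz_def r_def divide_inverse)
qed

lemma volterra_defect_eq:
  assumes "regular_point z"
  shows "volterra_defect \<tau> \<eta> N x t z = ansatz_log_deriv z
    + pole_ansatz \<tau> \<eta> N (\<lambda>j. x j t) (z + \<eta>) - pole_ansatz \<tau> \<eta> N (\<lambda>j. x j t) (z - \<eta>)"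
proof -
  have "pole_ansatz \<tau> \<eta> N (\<lambda>j. x j t) z \<noteq> 0"
    using assms by (simp add: regular_point_def pole_ansatz_def)
  then show ?thesis
    using vector_derivative_at[OF pole_ansatz_has_vector_derivative[OF assms]]
    by (simp add: volterra_defect_def)
qed

text \<open>The equation makes the defect vanish at all regular points, and a residue depends only
  on a punctured neighbourhood.\<close>

lemma residue_volterra_defect_eq_0:
  assumes "ansatz_solves_volterra \<tau> \<eta> N T x" and "t \<in> T"
  shows "residue (volterra_defect \<tau> \<eta> N x t) z0 = 0"
proof -
  have "\<forall>\<^sub>F z in at z0. volterra_defect \<tau> \<eta> N x t z = 0"
    using eventually_regular_point[of z0]
  proof eventually_elim
    case (elim z)
    then have "((\<lambda>s. pole_ansatz \<tau> \<eta> N (\<lambda>j. x j s) z) has_vector_derivative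
        - pole_ansatz \<tau> \<eta> N (\<lambda>j. x j t) z * (pole_ansatz \<tau> \<eta> N (\<lambda>j. x j t) (z + \<eta>)
          - pole_ansatz \<tau> \<eta> N (\<lambda>j. x j t) (z - \<eta>))) (at t)"
      using assms unfolding ansatz_solves_volterra_def regular_point_def Let_def by blast
    moreover have "pole_ansatz \<tau> \<eta> N (\<lambda>j. x j t) z \<noteq> 0"
      using elim by (simp add: regular_point_def pole_ansatz_def)
    ultimately show ?case
      by (simp add: volterra_defect_def vector_derivative_at)
  qed
  then have "residue (volterra_defect \<tau> \<eta> N x t) z0 = residue (\<lambda>_. 0) z0"
    by (rule residue_cong) simp
  then show ?thesis by (simp add: residue_const)
qed

lemma residue_ansatz_log_deriv:
  assumes "open S" and "z0 \<in> S" and S: "\<forall>z\<in>S - {z0}. regular_point z"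
  shows "ansatz_log_deriv holomorphic_on S - {z0}"
    and "residue ansatz_log_deriv z0 = (\<Sum>j=1..N. v j *
      (theta1_zero \<tau> (z0 - x j t) + theta1_zero \<tau> (z0 - (\<eta> + x j t))
       - theta1_zero \<tau> (z0 - (x j t - \<eta>)) - theta1_zero \<tau> (z0 - (2 * \<eta> + x j t))))"
proof -
  define \<zeta> where "\<zeta> = (\<lambda>a z. deriv (theta1 \<tau>) (z - a) / theta1 \<tau> (z - a))"
  have holo: "\<zeta> (x j t) holomorphic_on S - {z0}" "\<zeta> (\<eta> + x j t) holomorphic_on S - {z0}"
    "\<zeta> (x j t - \<eta>) holomorphic_on S - {z0}" "\<zeta> (2 * \<eta> + x j t) holomorphic_on S - {z0}"
    if "j \<in> {1..N}" for j
    unfolding \<zeta>_def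
    by (intro holomorphic_on_divide theta1_compose_holomorphic deriv_theta1_compose_holomorphic
        holomorphic_on_diff holomorphic_on_ident holomorphic_on_const regular_pointD[OF bspec[OF S] that]; assumption)+
  have L: "ansatz_log_deriv = (\<lambda>z. \<Sum>j=1..N. v j * (\<zeta> (x j t) z + \<zeta> (\<eta> + x j t) z
      - \<zeta> (x j t - \<eta>) z - \<zeta> (2 * \<eta> + x j t) z))"
    unfolding ansatz_log_deriv_def \<zeta>_def by simp
  have holo1: "(\<lambda>z. v j * (\<zeta> (x j t) z + \<zeta> (\<eta> + x j t) z - \<zeta> (x j t - \<eta>) z - \<zeta> (2 * \<eta> + x j t) z))
      holomorphic_on S - {z0}" if "j \<in> {1..N}" for j
    by (intro holomorphic_intros holo[OF that])
  then show "ansatz_log_deriv holomorphic_on S - {z0}"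
    unfolding L by (intro holomorphic_on_sum)
  have "residue ansatz_log_deriv z0 = (\<Sum>j=1..N. residue (\<lambda>z. v j * (\<zeta> (x j t) z + \<zeta> (\<eta> + x j t) z
      - \<zeta> (x j t - \<eta>) z - \<zeta> (2 * \<eta> + x j t) z)) z0)"
    unfolding L by (rule residue_sum[OF assms(1,2) _ holo1]) simp_all
  also have "\<dots> = (\<Sum>j=1..N. v j * (residue (\<zeta> (x j t)) z0 + residue (\<zeta> (\<eta> + x j t)) z0
      - residue (\<zeta> (x j t - \<eta>)) z0 - residue (\<zeta> (2 * \<eta> + x j t)) z0))"
  proof (rule sum.cong)
    fix j assume j: "j \<in> {1..N}"
    note h = holo[OF j]
    note rules = assms(1,2)
    show "residue (\<lambda>z. v j * (\<zeta> (x j t) z + \<zeta> (\<eta> + x j t) z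
      - \<zeta> (x j t - \<eta>) z - \<zeta> (2 * \<eta> + x j t) z)) z0 = v j * (residue (\<zeta> (x j t)) z0 + residue (\<zeta> (\<eta> + x j t)) z0
      - residue (\<zeta> (x j t - \<eta>)) z0 - residue (\<zeta> (2 * \<eta> + x j t)) z0)"
      by (simp add: residue_lmul[OF rules] residue_diff[OF rules] residue_add[OF rules]
          h holomorphic_on_add holomorphic_on_diff)
  qed simp
  finally show "residue ansatz_log_deriv z0 = (\<Sum>j=1..N. v j *
      (theta1_zero \<tau> (z0 - x j t) + theta1_zero \<tau> (z0 - (\<eta> + x j t))
       - theta1_zero \<tau> (z0 - (x j t - \<eta>)) - theta1_zero \<tau> (z0 - (2 * \<eta> + x j t))))"
    by (simp only: \<zeta>_def residue_theta1_log_deriv)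
qed

text \<open>
  If \<open>3 * \<eta>\<close> is congruent to some \<open>x j t - x k t\<close>, the poles at \<open>x j t - \<eta>\<close> and \<open>x k t + 2 * \<eta>\<close>
  collide, which nondegeneracy does not exclude. Writing the residue as a sum of indicators of
  zeros of the theta function covers this case without a distinction.
\<close>

lemma residue_volterra_defect:
  assumes nondeg: "nondegenerate \<tau> \<eta> N (\<lambda>j. x j t)"
  defines "A \<equiv> velocity1 \<tau> \<eta> N (\<lambda>j. x j t)" and "B \<equiv> velocity2 \<tau> \<eta> N (\<lambda>j. x j t)"
  shows "residue (volterra_defect \<tau> \<eta> N x t) z0 = (\<Sum>j=1..N.
    (v j - A j) * (theta1_zero \<tau> (z0 - x j t) - theta1_zero \<tau> (z0 - 2 * \<eta> - x j t))
    + (v j - B j) * (theta1_zero \<tau> (z0 - \<eta> - x j t) - theta1_zero \<tau> (z0 + \<eta> - x j t)))"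
proof -
  define c where "c = pole_ansatz \<tau> \<eta> N (\<lambda>j. x j t)"
  obtain r where r: "r > 0" "\<forall>z\<in>ball z0 r - {z0}. regular_point z"
    using eventually_regular_point[of z0] by (auto simp: eventually_at dist_commute)
  note ball = open_ball[of z0 r] centre_in_ball[THEN iffD2, OF r(1)]
  have hc: "(\<lambda>z. c (z + \<eta>)) holomorphic_on ball z0 r - {z0}" "(\<lambda>z. c (z - \<eta>)) holomorphic_on ball z0 r - {z0}"
    unfolding c_def pole_ansatz_def using r(2)
    by (auto intro!: holomorphic_intros rho_compose_holomorphic simp: regular_point_def)
  note hL = residue_ansatz_log_deriv[OF ball r(2)]
  have "residue (volterra_defect \<tau> \<eta> N x t) z0
      = residue (\<lambda>z. ansatz_log_deriv z + c (z + \<eta>) - c (z - \<eta>)) z0"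
  proof (rule residue_cong)
    show "\<forall>\<^sub>F z in at z0. volterra_defect \<tau> \<eta> N x t z = ansatz_log_deriv z + c (z + \<eta>) - c (z - \<eta>)"
      using eventually_regular_point[of z0]
      by eventually_elim (simp add: volterra_defect_eq c_def)
  qed simp
  also have "\<dots> = residue ansatz_log_deriv z0 + residue (\<lambda>z. c (z + \<eta>)) z0 - residue (\<lambda>z. c (z - \<eta>)) z0"
    using residue_diff[OF ball holomorphic_on_add[OF hL(1) hc(1)] hc(2)] residue_add[OF ball hL(1) hc(1)]
    by simp
  also have "residue (\<lambda>z. c (z + \<eta>)) z0 = residue c (z0 + \<eta>)"
    by (rule residue_shift)
  also have "residue (\<lambda>z. c (z - \<eta>)) z0 = residue c (z0 - \<eta>)"
    using residue_shift[of c "- \<eta>" z0] by simp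
  \<comment> \<open>The residue of \<open>c\<close> at \<open>z0 + \<eta>\<close> puts
    \<open>- A j\<close> at \<open>x j t\<close> and \<open>B j\<close> at
    \<open>x j t - \<eta>\<close>; the one at \<open>z0 - \<eta>\<close>, subtracted, puts
    \<open>- B j\<close> at \<open>x j t + \<eta>\<close> and \<open>A j\<close> at
    \<open>x j t + 2 * \<eta>\<close>.\<close>
  finally show ?thesis
    unfolding hL(2) c_def residue_pole_ansatz[OF nondeg] A_def B_def
    by (simp add: sum.distrib[symmetric] sum_subtractf[symmetric]) (simp add: algebra_simps)
qed

text \<open>For the forward direction it suffices to test at \<open>x j t\<close> and
  \<open>x j t + \<eta>\<close>. Nondegeneracy isolates one term of the sum at each of them, unlike
  at \<open>x j t - \<eta>\<close> and \<open>x j t + 2 * \<eta>\<close>, where poles may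
  collide.\<close>

lemma residues_vanish_iff:
  assumes nondeg: "nondegenerate \<tau> \<eta> N (\<lambda>j. x j t)"
  shows "(\<forall>z. residue (volterra_defect \<tau> \<eta> N x t) z = 0) \<longleftrightarrow>
    (\<forall>j\<in>{1..N}. v j = velocity1 \<tau> \<eta> N (\<lambda>j. x j t) j \<and> v j = velocity2 \<tau> \<eta> N (\<lambda>j. x j t) j)"
proof
  assume "\<forall>j\<in>{1..N}. v j = velocity1 \<tau> \<eta> N (\<lambda>j. x j t) j \<and> v j = velocity2 \<tau> \<eta> N (\<lambda>j. x j t) j"
  then show "\<forall>z. residue (volterra_defect \<tau> \<eta> N x t) z = 0"
    unfolding residue_volterra_defect[OF nondeg] by (auto intro!: sum.neutral)
next
  assume zero: "\<forall>z. residue (volterra_defect \<tau> \<eta> N x t) z = 0"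
  define A where "A = velocity1 \<tau> \<eta> N (\<lambda>j. x j t)"
  define B where "B = velocity2 \<tau> \<eta> N (\<lambda>j. x j t)"
  note res = residue_volterra_defect[OF nondeg, folded A_def B_def]
  show "\<forall>j\<in>{1..N}. v j = velocity1 \<tau> \<eta> N (\<lambda>j. x j t) j \<and> v j = velocity2 \<tau> \<eta> N (\<lambda>j. x j t) j"
    unfolding A_def[symmetric] B_def[symmetric]
  proof
    fix j assume j: "j \<in> {1..N}"
    note e = theta1_zero_config[OF nondeg j]
    have sum_delta: "(\<Sum>k=1..N. f k * of_bool (k = j)) = f j" for f :: "nat \<Rightarrow> complex"
      using j by (simp add: of_bool_def if_distrib cong: if_cong)
    have "residue (volterra_defect \<tau> \<eta> N x t) (x j t) = (\<Sum>k=1..N. (v k - A k) * of_bool (k = j))"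
      unfolding res
    proof (rule sum.cong)
      fix k assume k: "k \<in> {1..N}"
      have "x j t - 2 * \<eta> - x k t = x j t - x k t - 2 * \<eta>" "x j t - \<eta> - x k t = x j t - x k t - \<eta>"
        "x j t + \<eta> - x k t = x j t - x k t + \<eta>" by simp_all
      then show "(v k - A k) * (theta1_zero \<tau> (x j t - x k t) - theta1_zero \<tau> (x j t - 2 * \<eta> - x k t))
        + (v k - B k) * (theta1_zero \<tau> (x j t - \<eta> - x k t) - theta1_zero \<tau> (x j t + \<eta> - x k t))
        = (v k - A k) * of_bool (k = j)"
        using e[OF k] by (simp only:) simp
    qed simp
    then have "v j = A j" using zero sum_delta by simp
    moreover have "residue (volterra_defect \<tau> \<eta> N x t) (x j t + \<eta>) = (\<Sum>k=1..N. (v k - B k) * of_bool (k = j))"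
      unfolding res
    proof (rule sum.cong)
      fix k assume k: "k \<in> {1..N}"
      have "x j t + \<eta> - 2 * \<eta> - x k t = x j t - x k t - \<eta>" "x j t + \<eta> - \<eta> - x k t = x j t - x k t"
        "x j t + \<eta> + \<eta> - x k t = x j t - x k t + 2 * \<eta>" "x j t + \<eta> - x k t = x j t - x k t + \<eta>" by simp_all
      then show "(v k - A k) * (theta1_zero \<tau> (x j t + \<eta> - x k t) - theta1_zero \<tau> (x j t + \<eta> - 2 * \<eta> - x k t))
        + (v k - B k) * (theta1_zero \<tau> (x j t + \<eta> - \<eta> - x k t) - theta1_zero \<tau> (x j t + \<eta> + \<eta> - x k t))
        = (v k - B k) * of_bool (k = j)"
        using e[OF k] by (simp only:) simp
    qed simp
    then have "v j = B j" using zero sum_delta by simp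
    ultimately show "v j = A j \<and> v j = B j" ..
  qed
qed

end

section \<open>The two systems and the locus equations\<close>

lemma both_systems_iff:
  "both_systems \<tau> \<eta> N x t \<longleftrightarrow> (\<forall>j\<in>{1..N}. vector_derivative (x j) (at t) = velocity1 \<tau> \<eta> N (\<lambda>j. x j t) j \<and>
      vector_derivative (x j) (at t) = velocity2 \<tau> \<eta> N (\<lambda>j. x j t) j)"
proof -
  note d0 = deriv_theta1_at_zero[OF tau eta theta1_0]
  have "deriv (theta1 \<tau>) 0 / theta1 \<tau> (2 * \<eta>) * v = S \<longleftrightarrow> v = theta1 \<tau> (2 * \<eta>) / deriv (theta1 \<tau>) 0 * S" for v S
    using d0 eta2 by (auto simp: field_simps)
  then show ?thesis by (simp add: both_systems_def velocity1_def velocity2_def)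
qed

text \<open>The common denominator factor \<open>R 0\<close> cancels, and cross-multiplication gives
  the equality of numerator and denominator of the locus product.\<close>

lemma locus_equations_if_systems_agree:
  assumes nondeg: "nondegenerate \<tau> \<eta> N X"
    and eq: "\<And>j. j \<in> {1..N} \<Longrightarrow> system1_rhs \<tau> \<eta> N X j = system2_rhs \<tau> \<eta> N X j"
  shows "locus_equations \<tau> \<eta> N X"
  unfolding locus_equations_def
proof
  fix j assume j: "j \<in> {1..N}"
  define R where "R = config_prod \<tau> N X j"
  have R: "R 0 \<noteq> 0" "R \<eta> \<noteq> 0" "R (- \<eta>) \<noteq> 0" "R (2 * \<eta>) \<noteq> 0" "R (- 2 * \<eta>) \<noteq> 0"
    unfolding R_def by (rule config_prod_neq_0[OF nondeg j]; simp)+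
  note sys = system_rhs_eq_config_prod[where j = j and X = X and N = N and \<tau> = \<tau> and \<eta> = \<eta>, folded R_def]
  have "R (2 * \<eta>) * (R (- \<eta>))\<^sup>2 = R (- 2 * \<eta>) * (R \<eta>)\<^sup>2"
    using eq[OF j] R unfolding sys by (simp add: divide_simps power2_eq_square mult_ac)
  moreover have "(\<Prod>k\<in>{1..N} - {j}. theta1 \<tau> (X j - X k + 2 * \<eta>) * (theta1 \<tau> (X j - X k - \<eta>))\<^sup>2
      / (theta1 \<tau> (X j - X k - 2 * \<eta>) * (theta1 \<tau> (X j - X k + \<eta>))\<^sup>2))
    = R (2 * \<eta>) * (R (- \<eta>))\<^sup>2 / (R (- 2 * \<eta>) * (R \<eta>)\<^sup>2)"
    by (simp add: R_def config_prod_def prod_dividef prod.distrib prod_power_distrib)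
  ultimately show "(\<Prod>k\<in>{1..N} - {j}. theta1 \<tau> (X j - X k + 2 * \<eta>) * (theta1 \<tau> (X j - X k - \<eta>))\<^sup>2
      / (theta1 \<tau> (X j - X k - 2 * \<eta>) * (theta1 \<tau> (X j - X k + \<eta>))\<^sup>2)) = 1"
    using R by simp
qed

end

theorem mainTheorem4:
  fixes l N :: nat and \<tau> \<eta> :: complex and T :: "real set" and x :: "nat \<Rightarrow> real \<Rightarrow> complex"
  assumes "l \<ge> 1" and "N = l * (l + 1) div 2"
    and "Im \<tau> > 0"
    and "theta1 \<tau> \<eta> \<noteq> 0" and "theta1 \<tau> (2 * \<eta>) \<noteq> 0"
    and "open T"
    and "\<And>j t. j \<in> {1..N} \<Longrightarrow> t \<in> T \<Longrightarrow> x j differentiable at t"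
    and "\<And>t. t \<in> T \<Longrightarrow> nondegenerate \<tau> \<eta> N (\<lambda>j. x j t)"
  shows "(\<forall>t\<in>T. (\<forall>z. residue (volterra_defect \<tau> \<eta> N x t) z = 0) \<longleftrightarrow> both_systems \<tau> \<eta> N x t) \<and>
         (ansatz_solves_volterra \<tau> \<eta> N T x \<longrightarrow>
            (\<forall>t\<in>T. both_systems \<tau> \<eta> N x t \<and> locus_equations \<tau> \<eta> N (\<lambda>j. x j t))) \<and>
         (\<forall>t\<in>T. both_systems \<tau> \<eta> N x t \<longrightarrow>
            (\<forall>j\<in>{1..N}. system1_rhs \<tau> \<eta> N (\<lambda>i. x i t) j = system2_rhs \<tau> \<eta> N (\<lambda>i. x i t) j) \<and>
            locus_equations \<tau> \<eta> N (\<lambda>j. x j t))"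
proof -
  note ctx = assms(3,4,5)
  have deriv_x: "(x j has_vector_derivative vector_derivative (x j) (at t)) (at t)"
    if "j \<in> {1..N}" "t \<in> T" for j t
    using assms(7)[OF that] by (simp add: vector_derivative_works)
  have iff: "(\<forall>z. residue (volterra_defect \<tau> \<eta> N x t) z = 0) \<longleftrightarrow> both_systems \<tau> \<eta> N x t" if "t \<in> T" for t
    unfolding both_systems_iff[OF ctx]
    by (rule residues_vanish_iff[OF ctx deriv_x[OF _ that] assms(8)[OF that]])
  have agree: "system1_rhs \<tau> \<eta> N (\<lambda>i. x i t) j = system2_rhs \<tau> \<eta> N (\<lambda>i. x i t) j"
    if "both_systems \<tau> \<eta> N x t" "j \<in> {1..N}" for t j
    using that unfolding both_systems_def by metis
  have locus: "locus_equations \<tau> \<eta> N (\<lambda>j. x j t)" if "t \<in> T" "both_systems \<tau> \<eta> N x t" for t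
    using locus_equations_if_systems_agree[OF ctx assms(8)[OF that(1)] agree[OF that(2)]] .
  \<comment> \<open>A solution of the Volterra equation has a defect with vanishing residues, so the
    equivalence \<open>iff\<close> yields both systems.\<close>
  have "both_systems \<tau> \<eta> N x t" if "ansatz_solves_volterra \<tau> \<eta> N T x" "t \<in> T" for t
    using residue_volterra_defect_eq_0[OF ctx deriv_x[OF _ that(2)] that] iff[OF that(2)] by blast
  with iff agree locus show ?thesis by blast
qed

end
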